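(* Let $\epsilon>0$ and let $N$ be a positive integer. The set $\{\Phi\in\mathfrak{S}_N : \Phi \text{ satisfies the SESC}\}$ contains a subset of $\mathfrak{S}_N$ that is open and dense in $\mathfrak{S}_N$ with respect to the $\mathcal{C}^2$ topology (the topology induced by the metric $d_2$).
   Context: Fix $\epsilon>0$, write $I=[0,1]$ and, for $\delta>0$, $\mathcal{B}_\delta=\{z\in\mathbb{C}: \exists x\in I,\ |z-x|<\delta\}$. $\mathcal{S}^\omega_\epsilon(I)$ is the class of maps $f:\mathbb{R}\to\mathbb{R}$ such that: (A) $f$ is (extends to be) complex analytic on $\mathcal{B}_{2\epsilon}$; (B) $f(I)\subseteq I$ and $f(\overline{\mathcal{B}_\epsilon})\subseteq\mathcal{B}_\epsilon$; (C) $0<|f'(x)|<1$ for all $x\in\overline{\mathcal{B}_\epsilon}$. $\mathfrak{S}_N$ is the set of ordered $N$-tuples (IFSs) $\Phi=(f_i)_{i=1}^N$ with $f_i\in\mathcal{S}^\omega_\epsilon(I)$. For $f,g\in\mathcal{S}^\omega_\epsilon(I)$, $d_2(f,g)=\sup_{x\in I}|f(x)-g(x)|+\sup_{x\in I}|f'(x)-g'(x)|+\sup_{x\in I}|f''(x)-g''(x)|$, and $d_2((f_i)_{i=1}^N,(g_i)_{i=1}^N)=\max_i d_2(f_i,g_i)$ on $\mathfrak{S}_N$. Let $\mathcal{I}=\{1,\dots,N\}$, $\Sigma_n=\mathcal{I}^n$, and $f_{\mathbf{i}}=f_{i_1}\circ\cdots\circ f_{i_n}$ for $\mathbf{i}=(i_1,\dots,i_n)\in\Sigma_n$.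 $\Phi$ satisfies the strong exponential separation condition (SESC) if there exists $c>0$ such that $\sup_{x\in[0,1]}|f_{\mathbf{i}}(x)-f_{\mathbf{j}}(x)|\ge c^n$ for all $n\in\mathbb{N}$ and all $\mathbf{i}\ne\mathbf{j}$ in $\Sigma_n$. *)

theory Defs
  imports "HOL-Complex_Analysis.Complex_Analysis"
begin

definition B_nbhd :: "real \<Rightarrow> complex set" where
  "B_nbhd \<delta> = {z. \<exists>x\<in>{0..1::real}. cmod (z - complex_of_real x) < \<delta>}"

text \<open>
  \<open>F\<close> is the complex extension of \<open>f\<close>; it is uniquely determined on \<open>B_nbhd (2 * \<epsilon>)\<close>. Outside the
  real trace of that set the values of \<open>f\<close> are unconstrained.
\<close>

definition S_omega :: "real \<Rightarrow> (real \<Rightarrow> real) set" where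
  "S_omega \<epsilon> = {f. \<exists>F::complex \<Rightarrow> complex.
      F analytic_on B_nbhd (2 * \<epsilon>) \<and>
      (\<forall>x::real. complex_of_real x \<in> B_nbhd (2 * \<epsilon>) \<longrightarrow>
         F (complex_of_real x) = complex_of_real (f x)) \<and>
      f ` {0..1} \<subseteq> {0..1} \<and>
      F ` closure (B_nbhd \<epsilon>) \<subseteq> B_nbhd \<epsilon> \<and>
      (\<forall>z\<in>closure (B_nbhd \<epsilon>). 0 < cmod (deriv F z) \<and> cmod (deriv F z) < 1)}"

definition IFS :: "real \<Rightarrow> nat \<Rightarrow> (nat \<Rightarrow> real \<Rightarrow> real) set" where
  "IFS \<epsilon> N = {1..N} \<rightarrow>\<^sub>E S_omega \<epsilon>"

definition d2 :: "(real \<Rightarrow> real) \<Rightarrow> (real \<Rightarrow> real) \<Rightarrow> real" where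
  "d2 f g = (SUP x\<in>{0..1}. \<bar>f x - g x\<bar>)
          + (SUP x\<in>{0..1}. \<bar>deriv f x - deriv g x\<bar>)
          + (SUP x\<in>{0..1}. \<bar>deriv (deriv f) x - deriv (deriv g) x\<bar>)"

definition d2_IFS :: "nat \<Rightarrow> (nat \<Rightarrow> real \<Rightarrow> real) \<Rightarrow> (nat \<Rightarrow> real \<Rightarrow> real) \<Rightarrow> real" where
  "d2_IFS N \<Phi> \<Psi> = Max ((\<lambda>i. d2 (\<Phi> i) (\<Psi> i)) ` {1..N})"

text \<open>
  The library locale \<open>Metric_space\<close> does not apply literally: two maps on the real line that agree
  near \<open>{0..1}\<close> but differ far away have distance zero. The topology of the balls is
  therefore defined directly, by the same formula as in that locale.
\<close>

definition C2_topology :: "real \<Rightarrow> nat \<Rightarrow> (nat \<Rightarrow> real \<Rightarrow> real) topology" where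
  "C2_topology \<epsilon> N = topology (\<lambda>U. U \<subseteq> IFS \<epsilon> N \<and>
     (\<forall>\<Phi>\<in>U. \<exists>r>0. {\<Psi> \<in> IFS \<epsilon> N. d2_IFS N \<Phi> \<Psi> < r} \<subseteq> U))"

lemma openin_C2_topology:
  "openin (C2_topology \<epsilon> N) U \<longleftrightarrow>
     U \<subseteq> IFS \<epsilon> N \<and> (\<forall>\<Phi>\<in>U. \<exists>r>0. {\<Psi> \<in> IFS \<epsilon> N. d2_IFS N \<Phi> \<Psi> < r} \<subseteq> U)"
proof -
  let ?P = "\<lambda>U. U \<subseteq> IFS \<epsilon> N \<and> (\<forall>\<Phi>\<in>U. \<exists>r>0. {\<Psi> \<in> IFS \<epsilon> N. d2_IFS N \<Phi> \<Psi> < r} \<subseteq> U)"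
  have "istopology ?P"
    unfolding istopology_def
  proof (intro conjI allI impI)
    fix S T assume S: "?P S" and T: "?P T"
    show "S \<inter> T \<subseteq> IFS \<epsilon> N" using S by blast
    show "\<forall>\<Phi>\<in>S \<inter> T. \<exists>r>0. {\<Psi> \<in> IFS \<epsilon> N. d2_IFS N \<Phi> \<Psi> < r} \<subseteq> S \<inter> T"
    proof
      fix \<Phi> assume "\<Phi> \<in> S \<inter> T"
      then obtain r s where "r > 0" "{\<Psi> \<in> IFS \<epsilon> N. d2_IFS N \<Phi> \<Psi> < r} \<subseteq> S"
        and "s > 0" "{\<Psi> \<in> IFS \<epsilon> N. d2_IFS N \<Phi> \<Psi> < s} \<subseteq> T"
        using S T by blast
      then show "\<exists>r>0. {\<Psi> \<in> IFS \<epsilon> N. d2_IFS N \<Phi> \<Psi> < r} \<subseteq> S \<inter> T"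
        by (intro exI[of _ "min r s"]) auto
    qed
  next
    fix K assume K: "\<forall>S\<in>K. ?P S"
    show "\<Union>K \<subseteq> IFS \<epsilon> N" using K by blast
    show "\<forall>\<Phi>\<in>\<Union>K. \<exists>r>0. {\<Psi> \<in> IFS \<epsilon> N. d2_IFS N \<Phi> \<Psi> < r} \<subseteq> \<Union>K"
    proof
      fix \<Phi> assume "\<Phi> \<in> \<Union>K"
      then obtain S where "S \<in> K" "\<Phi> \<in> S" by blast
      then obtain r where "r > 0" "{\<Psi> \<in> IFS \<epsilon> N. d2_IFS N \<Phi> \<Psi> < r} \<subseteq> S"
        using K by blast
      then show "\<exists>r>0. {\<Psi> \<in> IFS \<epsilon> N. d2_IFS N \<Phi> \<Psi> < r} \<subseteq> \<Union>K"
        using \<open>S \<in> K\<close> by blast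
    qed
  qed
  then show ?thesis
    by (simp add: C2_topology_def topology_inverse')
qed

lemma topspace_C2_topology [simp]: "topspace (C2_topology \<epsilon> N) = IFS \<epsilon> N"
proof
  show "topspace (C2_topology \<epsilon> N) \<subseteq> IFS \<epsilon> N"
    using openin_C2_topology[of \<epsilon> N "topspace (C2_topology \<epsilon> N)"] by simp
  have "\<exists>r::real. r > 0" by (rule exI[of _ 1]) simp
  then have "openin (C2_topology \<epsilon> N) (IFS \<epsilon> N)"
    by (auto simp: openin_C2_topology)
  then show "IFS \<epsilon> N \<subseteq> topspace (C2_topology \<epsilon> N)" by (rule openin_subset)
qed

definition words :: "nat \<Rightarrow> nat \<Rightarrow> nat list set" where
  "words N n = {w. length w = n \<and> set w \<subseteq> {1..N}}"

definition comp_word :: "(nat \<Rightarrow> real \<Rightarrow> real) \<Rightarrow> nat list \<Rightarrow> real \<Rightarrow> real" where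
  "comp_word \<Phi> w = foldr (\<lambda>i g. \<Phi> i \<circ> g) w id"

definition SESC :: "nat \<Rightarrow> (nat \<Rightarrow> real \<Rightarrow> real) \<Rightarrow> bool" where
  "SESC N \<Phi> \<longleftrightarrow> (\<exists>c::real. c > 0 \<and>
     (\<forall>n::nat. \<forall>u\<in>words N n. \<forall>v\<in>words N n. u \<noteq> v \<longrightarrow>
        (SUP x\<in>{0..1}. \<bar>comp_word \<Phi> u x - comp_word \<Phi> v x\<bar>) \<ge> c ^ n))"

end

theory Submission
  imports Defs
begin

text \<open>
  The nonlinearity \<open>F'' / F'\<close> is a cocycle: for \<open>f_w \<circ> f_k\<close> it equals
  \<open>N(f_k) + f_k' * (N(f_w) \<circ> f_k)\<close>, a series that converges geometrically and is dominated by the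
  innermost maps. The open dense set consists of the systems for which there is a uniform gap on
  the unit interval between the nonlinearities of any two words with different innermost letters.

  The gap implies the SESC. Cancel the common innermost part of two words; it maps the unit
  interval onto an interval \<open>J\<close> of exponentially small length. The nonlinearities form a normal
  family, so by Montel's theorem some derivative of bounded order of their difference is bounded
  below at every point, and hence the difference is at least polynomially large in the length of \<open>J\<close>
  somewhere on \<open>J\<close>. Landau's interpolation inequality passes from this back to the maps.

  The gap is stable since the cocycle is a \<open>C\<^sup>2\<close>-continuous contraction. It is dense since one may add
  to \<open>f_k\<close> a multiple of \<open>z ^ n - z\<close> with \<open>n\<close> large: near the point \<open>1 + \<epsilon>\<close>, which no map of the system
  reaches, this shifts the nonlinearity by a prescribed large multiple of \<open>k\<close>, while it is small in
  \<open>C\<^sup>1\<close> on the whole neighbourhood and in \<open>C\<^sup>2\<close> on the images.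
\<close>

section \<open>Complex neighbourhoods of the unit interval\<close>

text \<open>Derivatives of compositions shrink exponentially, so the maps of long words cannot be
  compared uniformly. The nonlinearity is blind to that scale: post-composition with an invertible
  affine map does not change it. Hence all words have nonlinearities in one bounded family, and a
  single gap for infinitely many pairs makes sense. Returning to the maps costs fixed powers of
  quantities like \<open>s ^ n\<close>, which the SESC tolerates.

  The obstacle is that \<open>d2\<close> controls the maps on the real interval only. Stability has
  to be run along real orbits, which is why the gap is measured there. A C2-small change, however,
  moves the nonlinearities on the interval only slightly. The separation is therefore made at a
  point outside the interval, where \<open>d2\<close> sees nothing, and is carried back by
  normality: members of a bounded analytic family that are large at a fixed point of the
  neighbourhood cannot be arbitrarily small on the whole interval. Shifts proportional to the index
  of the letter separate all pairs at once, provided that their unit exceeds what the original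
  letters and the tails of the words can contribute.\<close>

abbreviation unit_seg :: "complex set" where
  "unit_seg \<equiv> complex_of_real ` {0..1}"

lemma compact_unit_seg: "compact unit_seg"
  by (intro compact_continuous_image continuous_intros) auto

lemma convex_of_real_image: "convex S \<Longrightarrow> convex (complex_of_real ` S)"
  by (intro convex_linear_image bounded_linear.linear bounded_linear_of_real)

lemma B_nbhd_eq_UN_ball: "B_nbhd \<rho> = (\<Union>x\<in>unit_seg. ball x \<rho>)"
  by (auto simp: B_nbhd_def dist_norm norm_minus_commute)

lemma B_nbhd_eq_sum: "B_nbhd \<rho> = (\<Union>x\<in>unit_seg. \<Union>y\<in>ball 0 \<rho>. {x + y})"
proof -
  have "\<exists>y\<in>ball 0 \<rho>. z = x + y" if "z \<in> ball x \<rho>" for z x :: complex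
    using that by (intro bexI[of _ "z - x"]) (auto simp: dist_norm norm_minus_commute)
  then show ?thesis
    unfolding B_nbhd_eq_UN_ball by (auto simp: dist_norm)
qed

lemma open_B_nbhd: "open (B_nbhd \<rho>)"
  unfolding B_nbhd_eq_UN_ball by auto

lemma convex_B_nbhd: "convex (B_nbhd \<rho>)"
  unfolding B_nbhd_eq_sum by (intro convex_sums convex_of_real_image convex_ball) auto

lemma ball_subset_B_nbhd: "x \<in> {0..1} \<Longrightarrow> ball (complex_of_real x) \<rho> \<subseteq> B_nbhd \<rho>"
  unfolding B_nbhd_eq_UN_ball by auto

lemma of_real_in_B_nbhd: "x \<in> {0..1} \<Longrightarrow> 0 < \<rho> \<Longrightarrow> complex_of_real x \<in> B_nbhd \<rho>"
  unfolding B_nbhd_eq_UN_ball by force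

lemma unit_seg_subset_B_nbhd: "0 < \<rho> \<Longrightarrow> unit_seg \<subseteq> B_nbhd \<rho>"
  using of_real_in_B_nbhd by auto

lemma B_nbhd_mono: "\<rho> \<le> \<rho>' \<Longrightarrow> B_nbhd \<rho> \<subseteq> B_nbhd \<rho>'"
  unfolding B_nbhd_def by force

text \<open>Membership becomes a strict inequality for a continuous function. This gives the
  inclusions between closures and, by compactness, a quantitative margin for the images.\<close>

lemma B_nbhd_eq_infdist: "B_nbhd \<rho> = {z. infdist z unit_seg < \<rho>}"
proof (intro equalityI subsetI CollectI)
  fix z assume "z \<in> B_nbhd \<rho>"
  then obtain x where x: "x \<in> unit_seg" "dist z x < \<rho>"
    by (auto simp: B_nbhd_def dist_norm)
  then show "infdist z unit_seg < \<rho>"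
    using infdist_le[OF x(1), of z] by simp
next
  fix z assume "z \<in> {z. infdist z unit_seg < \<rho>}"
  moreover obtain x where "x \<in> unit_seg" "infdist z unit_seg = dist z x"
    using infdist_attains_inf[of unit_seg z] compact_unit_seg by (auto dest: compact_imp_closed)
  ultimately show "z \<in> B_nbhd \<rho>"
    by (auto simp: B_nbhd_def dist_norm)
qed

lemma closure_B_nbhd_subset: "closure (B_nbhd \<rho>) \<subseteq> {z. infdist z unit_seg \<le> \<rho>}"
proof (rule closure_minimal)
  show "closed {z. infdist z unit_seg \<le> \<rho>}"
    by (intro closed_Collect_le continuous_intros)
qed (auto simp: B_nbhd_eq_infdist)

lemma closure_B_nbhd_subset_B_nbhd: "\<rho> < \<rho>' \<Longrightarrow> closure (B_nbhd \<rho>) \<subseteq> B_nbhd \<rho>'"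
  using closure_B_nbhd_subset by (force simp: B_nbhd_eq_infdist)

text \<open>A disc about 0 around the neighbourhood, on which powers of \<open>z\<close> are easy to
  estimate.\<close>

lemma norm_less_if_in_B_nbhd: "z \<in> B_nbhd \<rho> \<Longrightarrow> cmod z < 1 + \<rho>"
proof -
  assume "z \<in> B_nbhd \<rho>"
  then obtain x where "x \<in> {0..1}" "cmod (z - complex_of_real x) < \<rho>"
    by (auto simp: B_nbhd_def)
  then show ?thesis
    using norm_triangle_sub[of z "complex_of_real x"] by auto
qed

lemma norm_le_if_in_closure_B_nbhd: "z \<in> closure (B_nbhd \<rho>) \<Longrightarrow> cmod z \<le> 1 + \<rho>"
proof -
  have "closure (B_nbhd \<rho>) \<subseteq> cball 0 (1 + \<rho>)"
    by (rule closure_minimal) (auto dest: norm_less_if_in_B_nbhd)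
  then show "z \<in> closure (B_nbhd \<rho>) \<Longrightarrow> cmod z \<le> 1 + \<rho>" by auto
qed

lemma compact_closure_B_nbhd: "compact (closure (B_nbhd \<rho>))"
  unfolding compact_closure bounded_iff using norm_less_if_in_B_nbhd less_imp_le by blast

lemma closure_B_nbhd_mem: "z \<in> B_nbhd \<rho> \<Longrightarrow> z \<in> closure (B_nbhd \<rho>)"
  using closure_subset by blast

section \<open>Cauchy estimates and Landau interpolation\<close>

lemma higher_deriv_bound_unit_seg:
  assumes hol: "g holomorphic_on B_nbhd \<rho>" and bd: "\<And>z. z \<in> B_nbhd \<rho> \<Longrightarrow> cmod (g z) \<le> C"
    and "0 < \<rho>" and x: "x \<in> {0..1}"
  shows "cmod ((deriv ^^ j) g (complex_of_real x)) \<le> fact j * C / (\<rho> / 2) ^ j"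
proof -
  \<comment> \<open>Half the radius keeps the closed disc inside the open neighbourhood.\<close>
  have sub: "cball (complex_of_real x) (\<rho> / 2) \<subseteq> B_nbhd \<rho>"
    using ball_subset_B_nbhd[OF x, of \<rho>] \<open>0 < \<rho>\<close> by (auto simp: subset_iff)
  show ?thesis
  proof (rule Cauchy_inequality)
    show "g holomorphic_on ball (complex_of_real x) (\<rho> / 2)"
      using sub by (intro holomorphic_on_subset[OF hol]) auto
    show "continuous_on (cball (complex_of_real x) (\<rho> / 2)) g"
      by (rule holomorphic_on_imp_continuous_on[OF holomorphic_on_subset[OF hol sub]])
    show "0 < \<rho> / 2" using \<open>0 < \<rho>\<close> by simp
    show "cmod (g z) \<le> C" if "cmod (complex_of_real x - z) = \<rho> / 2" for z
      using that sub by (intro bd) (auto simp: dist_norm subset_iff)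
  qed
qed

lemma has_deriv_B_nbhd:
  assumes "g holomorphic_on B_nbhd \<rho>" "z \<in> B_nbhd \<rho>"
  shows "(g has_field_derivative deriv g z) (at z)"
  using holomorphic_derivI[OF assms(1) open_B_nbhd assms(2)] .

text \<open>If \<open>g\<close> were below \<open>s\<^sup>2\<close> on the whole subinterval,
  Taylor's formula over a step of length \<open>s\<close> from \<open>x\<close> would give
  \<open>\<kappa> * s < (2 + M) * s\<^sup>2\<close>, which the choice of \<open>s\<close>
  excludes.\<close>

lemma Landau_lower_bound:
  assumes hol: "g holomorphic_on B_nbhd \<rho>" and "0 < \<rho>"
    and M: "\<And>x. x \<in> {0..1} \<Longrightarrow> cmod (deriv (deriv g) (complex_of_real x)) \<le> M"
    and ab: "0 \<le> a" "a < b" "b \<le> 1"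
    and x: "x \<in> {a..b}" "\<kappa> \<le> cmod (deriv g (complex_of_real x))" and "0 < \<kappa>" "\<kappa> \<le> 1"
  shows "\<exists>y\<in>{a..b}. (\<kappa> * (b - a) / (4 + M))\<^sup>2 \<le> cmod (g (complex_of_real y))"
proof (rule ccontr)
  assume contr: "\<not> ?thesis"
  define s where "s = \<kappa> * (b - a) / (4 + M)"
  have small: "cmod (g (complex_of_real y)) < s\<^sup>2" if "y \<in> {a..b}" for y
    using contr that unfolding s_def by force
  have "0 \<le> M" using M[of 0] by (auto intro: order_trans[OF norm_ge_zero])
  then have "0 < s" using ab \<open>0 < \<kappa>\<close> by (simp add: s_def)
  have "\<kappa> * (b - a) \<le> b - a"
    using \<open>\<kappa> \<le> 1\<close> ab by (intro mult_left_le_one_le) (use \<open>0 < \<kappa>\<close> in auto)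
  then have "s * 4 \<le> b - a"
  proof -
    have "s * (4 + M) = \<kappa> * (b - a)" using \<open>0 \<le> M\<close> by (simp add: s_def)
    moreover have "0 \<le> s * M" using \<open>0 < s\<close> \<open>0 \<le> M\<close> by simp
    ultimately show ?thesis using \<open>\<kappa> * (b - a) \<le> b - a\<close> by (simp add: algebra_simps)
  qed
  \<comment> \<open>A step of length exactly \<open>s\<close> to the right or to the left stays in
    the interval, because \<open>4 * s\<close> is at most its length. This is where the 4 in
    \<open>s\<close> comes from.\<close>
  then obtain y where y: "y \<in> {a..b}" "\<bar>y - x\<bar> = s"
  proof (cases "x + s \<le> b")
    case True
    then show ?thesis using x \<open>0 < s\<close> that[of "x + s"] by auto
  next
    case False
    then show ?thesis using x \<open>0 < s\<close> \<open>s * 4 \<le> b - a\<close> that[of "x - s"] by auto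
  qed
  define f where "f = (\<lambda>i::nat. (deriv ^^ i) g)"
  have "cmod (f 0 (complex_of_real y) -
      (\<Sum>i\<le>1. f i (complex_of_real x) * (complex_of_real y - complex_of_real x) ^ i / fact i))
      \<le> M * cmod (complex_of_real y - complex_of_real x) ^ Suc 1 / fact 1"
  proof (rule complex_Taylor[where S = unit_seg])
    show "convex unit_seg" by (intro convex_of_real_image) auto
    show "(f i has_field_derivative f (Suc i) z) (at z within unit_seg)" if "z \<in> unit_seg" for i z
    proof -
      have "f i holomorphic_on B_nbhd \<rho>"
        unfolding f_def by (intro holomorphic_higher_deriv hol open_B_nbhd)
      from has_deriv_B_nbhd[OF this] show ?thesis
        using that unit_seg_subset_B_nbhd[OF \<open>0 < \<rho>\<close>] by (auto simp: f_def intro: DERIV_subset)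
    qed
    show "cmod (f (Suc 1) z) \<le> M" if "z \<in> unit_seg" for z
      using that M by (auto simp: f_def)
  qed (use x y ab in auto)
  also have "cmod (complex_of_real y - complex_of_real x) = s"
    using y by (metis of_real_diff norm_of_real)
  finally have "cmod (g (complex_of_real y) - g (complex_of_real x) -
      deriv g (complex_of_real x) * (complex_of_real y - complex_of_real x)) \<le> M * s\<^sup>2"
    by (simp add: f_def algebra_simps power2_eq_square)
  moreover have "cmod (deriv g (complex_of_real x) * (complex_of_real y - complex_of_real x))
      \<ge> \<kappa> * s"
    using x y \<open>0 < s\<close> by (simp add: norm_mult flip: of_real_diff)
  moreover have "cmod (g (complex_of_real y)) < s\<^sup>2" "cmod (g (complex_of_real x)) < s\<^sup>2"
    using small x y by auto
  moreover have "cmod w \<le> cmod (u - v - w) + cmod u + cmod v" for u v w :: complex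
    by norm
  ultimately have "\<kappa> * s < 2 * s\<^sup>2 + M * s\<^sup>2"
    by (smt (verit, best))
  then have "\<kappa> * s < ((2 + M) * s) * s" by (simp add: algebra_simps power2_eq_square)
  then have "\<kappa> < (2 + M) * s" using \<open>0 < s\<close> by (simp add: mult_less_cancel_right)
  also have "\<dots> \<le> (4 + M) * s" using \<open>0 < s\<close> by (simp add: algebra_simps)
  also have "\<dots> = \<kappa> * (b - a)" using \<open>0 \<le> M\<close> by (simp add: s_def)
  also have "\<dots> \<le> \<kappa>" using ab \<open>0 < \<kappa>\<close> by (simp add: mult_left_le)
  finally show False by simp
qed

text \<open>One application of Landau's inequality turns a lower bound \<open>q ^ e\<close> for the
  derivative into \<open>(q ^ e * q) ^ 2\<close> for the function.\<close>

fun landau_exp :: "nat \<Rightarrow> nat" where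
  "landau_exp 0 = 1"
| "landau_exp (Suc j) = 2 * landau_exp j + 2"

lemma landau_exp_mono: "i \<le> j \<Longrightarrow> landau_exp i \<le> landau_exp j"
  by (induction rule: dec_induct) auto

text \<open>The induction strips one derivative at a time by passing from \<open>g\<close> to
  \<open>deriv g\<close>. The same base, containing the length of the interval and \<open>M\<close>,
  serves at every level, so only the exponent grows.\<close>

lemma iterated_Landau_lower_bound:
  assumes "g holomorphic_on B_nbhd \<rho>" and "0 < \<rho>"
    and "\<And>i x. i \<le> Suc j \<Longrightarrow> x \<in> {0..1} \<Longrightarrow> cmod ((deriv ^^ i) g (complex_of_real x)) \<le> M"
    and ab: "0 \<le> a" "a < b" "b \<le> 1"
    and "x \<in> {a..b}" "\<kappa> \<le> cmod ((deriv ^^ j) g (complex_of_real x))" and \<kappa>: "0 < \<kappa>" "\<kappa> \<le> 1"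
  shows "\<exists>y\<in>{a..b}. (\<kappa> * (b - a) / (4 + M)) ^ landau_exp j \<le> cmod (g (complex_of_real y))"
  using assms(1,3,7,8)
proof (induction j arbitrary: g)
  case 0
  have "0 \<le> M" using "0.prems"(2)[of 0 0] by (auto intro: order_trans[OF norm_ge_zero])
  have "\<kappa> * (b - a) / (4 + M) \<le> \<kappa> * (b - a)"
  proof -
    have "0 \<le> \<kappa> * (b - a)" using ab \<kappa> by simp
    then have "\<kappa> * (b - a) * 1 \<le> \<kappa> * (b - a) * (4 + M)"
      using \<open>0 \<le> M\<close> by (intro mult_left_mono) auto
    then show ?thesis using \<open>0 \<le> M\<close> by (simp add: divide_le_eq)
  qed
  also have "\<dots> \<le> \<kappa>" using ab \<kappa> by (simp add: mult_left_le)
  finally show ?case using 0 by (intro bexI[of _ x]) auto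
next
  case (Suc j)
  define q where "q = \<kappa> * (b - a) / (4 + M)"
  have "0 \<le> M" using Suc.prems(2)[of 0 0] by (auto intro: order_trans[OF norm_ge_zero])
  have q: "0 < q" "q \<le> (b - a) / (4 + M)"
    using \<open>0 \<le> M\<close> ab \<kappa> by (auto simp: q_def intro!: divide_right_mono mult_left_le_one_le)
  have "(b - a) / (4 + M) \<le> 1"
    using \<open>0 \<le> M\<close> ab by (simp add: divide_le_eq)
  have "q \<le> 1" using q \<open>(b - a) / (4 + M) \<le> 1\<close> by linarith
  have shift: "(deriv ^^ i) (deriv g) = (deriv ^^ Suc i) g" for i
    by (simp only: funpow_Suc_right o_apply)
  have "\<exists>y\<in>{a..b}. q ^ landau_exp j \<le> cmod (deriv g (complex_of_real y))"
    unfolding q_def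
  proof (rule Suc.IH)
    show "deriv g holomorphic_on B_nbhd \<rho>"
      by (intro holomorphic_deriv Suc.prems open_B_nbhd)
    show "cmod ((deriv ^^ i) (deriv g) (complex_of_real x)) \<le> M" if "i \<le> Suc j" "x \<in> {0..1}" for i x
      using Suc.prems(2)[of "Suc i" x] that unfolding shift by simp
    show "\<kappa> \<le> cmod ((deriv ^^ j) (deriv g) (complex_of_real x))"
      using Suc.prems(4) unfolding shift .
  qed (use Suc.prems in auto)
  then obtain y where y: "y \<in> {a..b}" "q ^ landau_exp j \<le> cmod (deriv g (complex_of_real y))"
    by blast
  have "\<exists>z\<in>{a..b}. (q ^ landau_exp j * (b - a) / (4 + M))\<^sup>2 \<le> cmod (g (complex_of_real z))"
  proof (rule Landau_lower_bound[OF Suc.prems(1) \<open>0 < \<rho>\<close> _ ab y])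
    show "cmod (deriv (deriv g) (complex_of_real x)) \<le> M" if "x \<in> {0..1}" for x
      using Suc.prems(2)[of 2 x] that by (simp add: numeral_2_eq_2)
    show "0 < q ^ landau_exp j" "q ^ landau_exp j \<le> 1"
      using q \<open>q \<le> 1\<close> by (auto intro: power_le_one)
  qed
  moreover have "q ^ landau_exp (Suc j) = (q ^ landau_exp j * q)\<^sup>2"
    by (simp add: power_mult_distrib power_add power_mult[symmetric] mult.commute power2_eq_square[of q])
  \<comment> \<open>The fresh factor \<open>(b - a) / (4 + M)\<close> is lowered to
    \<open>q\<close>, which is possible as \<open>\<kappa> \<le> 1\<close>; a pure power of
    \<open>q\<close> remains.\<close>
  moreover have "(q ^ landau_exp j * q)\<^sup>2 \<le> (q ^ landau_exp j * ((b - a) / (4 + M)))\<^sup>2"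
    using q by (intro power_mono mult_left_mono) auto
  ultimately show ?case unfolding q_def[symmetric] by (auto intro: order_trans)
qed

section \<open>Propagation of smallness\<close>

lemma higher_deriv_lipschitz_unit_seg:
  assumes hol: "g holomorphic_on B_nbhd \<rho>" and bd: "\<And>z. z \<in> B_nbhd \<rho> \<Longrightarrow> cmod (g z) \<le> C"
    and "0 < \<rho>" and "x \<in> {0..1}" "y \<in> {0..1}"
  shows "cmod ((deriv ^^ j) g (complex_of_real x) - (deriv ^^ j) g (complex_of_real y))
    \<le> fact (Suc j) * C / (\<rho> / 2) ^ Suc j * \<bar>x - y\<bar>"
proof -
  have "cmod ((deriv ^^ j) g (complex_of_real x) - (deriv ^^ j) g (complex_of_real y))
    \<le> fact (Suc j) * C / (\<rho> / 2) ^ Suc j * cmod (complex_of_real x - complex_of_real y)"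
  proof (rule field_differentiable_bound[where S = unit_seg])
    show "convex unit_seg" by (intro convex_of_real_image) auto
    show "((deriv ^^ j) g has_field_derivative (deriv ^^ Suc j) g z) (at z within unit_seg)"
      if "z \<in> unit_seg" for z
    proof -
      have "(deriv ^^ j) g holomorphic_on B_nbhd \<rho>"
        by (intro holomorphic_higher_deriv hol open_B_nbhd)
      then have "((deriv ^^ j) g has_field_derivative deriv ((deriv ^^ j) g) z) (at z)"
        using that unit_seg_subset_B_nbhd[OF \<open>0 < \<rho>\<close>] by (intro has_deriv_B_nbhd) auto
      then show ?thesis by (simp add: has_field_derivative_at_within)
    qed
    show "cmod ((deriv ^^ Suc j) g z) \<le> fact (Suc j) * C / (\<rho> / 2) ^ Suc j" if "z \<in> unit_seg" for z
      using that higher_deriv_bound_unit_seg[OF hol bd \<open>0 < \<rho>\<close>, of _ "Suc j"] by auto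
  qed (use assms in auto)
  then show ?thesis by (simp flip: of_real_diff)
qed

text \<open>A compactness argument. Counterexamples for all orders have a subsequence along which
  the functions converge locally uniformly and the base points converge. Every derivative of the
  limit vanishes at the limit point, so by the identity theorem the limit is 0 on the connected
  neighbourhood. This contradicts the lower bound \<open>\<delta>\<close> somewhere on the compact
  set \<open>K\<close>.\<close>

lemma higher_deriv_lower_bound_by_normality:
  assumes "0 < \<rho>" "0 < \<delta>" and K: "compact K" "K \<subseteq> B_nbhd \<rho>"
  shows "\<exists>n \<eta>. 0 < \<eta> \<and> (\<forall>g x. g holomorphic_on B_nbhd \<rho> \<longrightarrow> (\<forall>z\<in>B_nbhd \<rho>. cmod (g z) \<le> C) \<longrightarrow>
    (\<exists>z\<in>K. \<delta> \<le> cmod (g z)) \<longrightarrow> x \<in> {0..1} \<longrightarrow>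
    (\<exists>j\<le>n. \<eta> \<le> cmod ((deriv ^^ j) g (complex_of_real x))))"
proof (rule ccontr)
  define P where "P = (\<lambda>g. g holomorphic_on B_nbhd \<rho> \<and> (\<forall>z\<in>B_nbhd \<rho>. cmod (g z) \<le> C) \<and>
    (\<exists>z\<in>K. \<delta> \<le> cmod (g z)))"
  assume contr: "\<not> ?thesis"
  have "\<forall>n. \<exists>gx. P (fst gx) \<and> snd gx \<in> {0..1} \<and>
      (\<forall>j\<le>n. cmod ((deriv ^^ j) (fst gx) (complex_of_real (snd gx))) < inverse (real (Suc n)))"
  proof
    fix n
    \<comment> \<open>The order and the threshold are tied together: the threshold for order
      \<open>n\<close> is \<open>1 / (n + 1)\<close>, so in the limit all derivatives are forced to
      vanish.\<close>
    have "\<not> (0 < inverse (real (Suc n)) \<and> (\<forall>g x. g holomorphic_on B_nbhd \<rho> \<longrightarrow>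
        (\<forall>z\<in>B_nbhd \<rho>. cmod (g z) \<le> C) \<longrightarrow> (\<exists>z\<in>K. \<delta> \<le> cmod (g z)) \<longrightarrow> x \<in> {0..1} \<longrightarrow>
        (\<exists>j\<le>n. inverse (real (Suc n)) \<le> cmod ((deriv ^^ j) g (complex_of_real x)))))"
      by (rule contr[unfolded not_ex, rule_format])
    moreover have "0 < inverse (real (Suc n))" by simp
    ultimately obtain g x where "P g" "x \<in> {0..1}"
      "\<not> (\<exists>j\<le>n. inverse (real (Suc n)) \<le> cmod ((deriv ^^ j) g (complex_of_real x)))"
      unfolding P_def by blast
    then have "P g \<and> x \<in> {0..1} \<and>
        (\<forall>j\<le>n. cmod ((deriv ^^ j) g (complex_of_real x)) < inverse (real (Suc n)))"
      by (meson not_le)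
    then show "\<exists>gx. P (fst gx) \<and> snd gx \<in> {0..1} \<and>
      (\<forall>j\<le>n. cmod ((deriv ^^ j) (fst gx) (complex_of_real (snd gx))) < inverse (real (Suc n)))"
      by (intro exI[of _ "(g, x)"], unfold fst_conv snd_conv)
  qed
  from choice[OF this] obtain gx where gx: "\<forall>n. P (fst (gx n)) \<and> snd (gx n) \<in> {0..1} \<and>
      (\<forall>j\<le>n. cmod ((deriv ^^ j) (fst (gx n)) (complex_of_real (snd (gx n))))
        < inverse (real (Suc n)))" ..
  define g where "g = fst \<circ> gx"
  define x where "x = snd \<circ> gx"
  have Pg: "P (g n)" and x: "x n \<in> {0..1}" for n
    using gx[rule_format, of n] by (simp_all only: g_def x_def o_apply)
  have small: "cmod ((deriv ^^ j) (g n) (complex_of_real (x n))) < inverse (real (Suc n))"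
    if "j \<le> n" for j n
    using gx[rule_format, of n] that by (simp only: g_def x_def o_apply)
  have "seq_compact {0..1::real}"
    by (rule compact_imp_seq_compact) simp
  then obtain l r where l: "l \<in> {0..1}" and r: "strict_mono r" and "(x \<circ> r) \<longlonglongrightarrow> l"
    by (rule seq_compactE) (rule allI, rule x)
  obtain h s where h: "h holomorphic_on B_nbhd \<rho>" and s: "strict_mono s"
    and lim: "\<And>K. compact K \<Longrightarrow> K \<subseteq> B_nbhd \<rho> \<Longrightarrow> uniform_limit K ((g \<circ> r) \<circ> s) h sequentially"
  proof (rule Montel[of "B_nbhd \<rho>" "Collect P" "g \<circ> r"])
    show "\<exists>B. \<forall>h\<in>Collect P. \<forall>z\<in>K. cmod (h z) \<le> B" if "K \<subseteq> B_nbhd \<rho>" for K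
      using that by (intro exI[of _ C]) (auto simp: P_def)
  qed (use Pg in \<open>auto simp: open_B_nbhd P_def\<close>)
  define t where "t = r \<circ> s"
  have t: "strict_mono t" unfolding t_def using r s by (rule strict_mono_o)
  have gt: "(g \<circ> r) \<circ> s = (\<lambda>n. g (t n))" by (auto simp: t_def)
  have "(\<lambda>n. x (t n)) \<longlonglongrightarrow> l"
    using LIMSEQ_subseq_LIMSEQ[OF \<open>(x \<circ> r) \<longlonglongrightarrow> l\<close> s] by (simp add: t_def o_def)
  define A where "A = ball (complex_of_real l) (\<rho> / 2)"
  have "cball (complex_of_real l) (\<rho> / 2) \<subseteq> B_nbhd \<rho>"
    using ball_subset_B_nbhd[OF l, of \<rho>] \<open>0 < \<rho>\<close> by (auto simp: subset_iff)
  then have "uniform_limit A (\<lambda>n. g (t n)) h sequentially"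
    using uniform_limit_on_subset[OF lim[of "cball (complex_of_real l) (\<rho> / 2)"], of A]
    by (auto simp: A_def gt)
  have "(deriv ^^ j) h (complex_of_real l) = 0" for j
  proof (rule LIMSEQ_unique)
    show "(\<lambda>n. (deriv ^^ j) (g (t n)) (complex_of_real l)) \<longlonglongrightarrow> (deriv ^^ j) h (complex_of_real l)"
    proof (rule higher_deriv_complex_uniform_limit[OF \<open>uniform_limit A _ h sequentially\<close>])
      have "g (t n) holomorphic_on A" for n
      proof (rule holomorphic_on_subset)
        show "g (t n) holomorphic_on B_nbhd \<rho>" using Pg[of "t n"] by (simp add: P_def)
        show "A \<subseteq> B_nbhd \<rho>"
          using \<open>cball (complex_of_real l) (\<rho> / 2) \<subseteq> B_nbhd \<rho>\<close> ball_subset_cball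
          unfolding A_def by blast
      qed
      then show "\<forall>\<^sub>F n in sequentially. g (t n) holomorphic_on A" by simp
    qed (use \<open>0 < \<rho>\<close> in \<open>auto simp: A_def\<close>)
    let ?L = "fact (Suc j) * C / (\<rho> / 2) ^ Suc j"
    show "(\<lambda>n. (deriv ^^ j) (g (t n)) (complex_of_real l)) \<longlonglongrightarrow> 0"
    proof (rule Lim_null_comparison)
      \<comment> \<open>Smallness is known at the moving point \<open>x (t n)\<close> only; the
        uniform Lipschitz bound transports it to \<open>l\<close>. As \<open>n \<le> t n\<close>,
        order \<open>j\<close> is covered from \<open>n = j\<close> on.\<close>
      have "cmod ((deriv ^^ j) (g (t n)) (complex_of_real l))
          \<le> ?L * \<bar>l - x (t n)\<bar> + inverse (real (Suc n))" if "j \<le> n" for n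
      proof -
        have "n \<le> t n" using t by (rule strict_mono_imp_increasing)
        have "cmod ((deriv ^^ j) (g (t n)) (complex_of_real l) -
            (deriv ^^ j) (g (t n)) (complex_of_real (x (t n)))) \<le> ?L * \<bar>l - x (t n)\<bar>"
          using Pg[of "t n"] x l \<open>0 < \<rho>\<close>
          by (intro higher_deriv_lipschitz_unit_seg) (auto simp: P_def)
        moreover have "cmod ((deriv ^^ j) (g (t n)) (complex_of_real (x (t n))))
            < inverse (real (Suc (t n)))"
          using small \<open>j \<le> n\<close> \<open>n \<le> t n\<close> by simp
        moreover have "inverse (real (Suc (t n))) \<le> inverse (real (Suc n))"
          using \<open>n \<le> t n\<close> by (intro le_imp_inverse_le) auto
        ultimately show ?thesis
          using norm_triangle_sub[of "(deriv ^^ j) (g (t n)) (complex_of_real l)"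
              "(deriv ^^ j) (g (t n)) (complex_of_real (x (t n)))"] by linarith
      qed
      then show "\<forall>\<^sub>F n in sequentially. cmod ((deriv ^^ j) (g (t n)) (complex_of_real l))
          \<le> ?L * \<bar>l - x (t n)\<bar> + inverse (real (Suc n))"
        by (rule eventually_sequentiallyI)
      have "(\<lambda>n. ?L * \<bar>l - x (t n)\<bar> + inverse (real (Suc n))) \<longlonglongrightarrow> ?L * \<bar>l - l\<bar> + 0"
        by (intro tendsto_intros \<open>(\<lambda>n. x (t n)) \<longlonglongrightarrow> l\<close> LIMSEQ_inverse_real_of_nat)
      then show "(\<lambda>n. ?L * \<bar>l - x (t n)\<bar> + inverse (real (Suc n))) \<longlonglongrightarrow> 0" by simp
    qed
  qed
  then have h0: "h z = 0" if "z \<in> B_nbhd \<rho>" for z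
    using holomorphic_fun_eq_0_on_connected[OF h open_B_nbhd, of "complex_of_real l" z]
      that l \<open>0 < \<rho>\<close> convex_connected[OF convex_B_nbhd] of_real_in_B_nbhd by auto
  have "\<forall>\<^sub>F n in sequentially. \<forall>z\<in>K. dist (g (t n) z) (h z) < \<delta>"
    using uniform_limitD[OF lim[OF K] \<open>0 < \<delta>\<close>] by (simp add: gt o_def t_def)
  then obtain n where "\<forall>z\<in>K. dist (g (t n) z) (h z) < \<delta>"
    by (auto simp: eventually_sequentially)
  moreover obtain z where "z \<in> K" "\<delta> \<le> cmod (g (t n) z)"
    using Pg[of "t n"] by (auto simp: P_def)
  moreover have "h z = 0" using h0 K(2) \<open>z \<in> K\<close> by blast
  ultimately show False by (auto simp: dist_norm)
qed

lemma higher_derivs_uniformly_bounded: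
  assumes "0 < \<rho>"
  obtains M where "0 \<le> M"
    "\<And>g i x. g holomorphic_on B_nbhd \<rho> \<Longrightarrow> (\<And>z. z \<in> B_nbhd \<rho> \<Longrightarrow> cmod (g z) \<le> C) \<Longrightarrow> i \<le> n \<Longrightarrow>
      x \<in> {0..1} \<Longrightarrow> cmod ((deriv ^^ i) g (complex_of_real x)) \<le> M"
proof
  \<comment> \<open>The sum stands in for a maximum over the orders; the absolute values make it
    valid whatever the sign of \<open>C\<close>.\<close>
  let ?M = "\<Sum>i\<le>n. \<bar>fact i * C / (\<rho> / 2) ^ i\<bar>"
  show "0 \<le> ?M" by (intro sum_nonneg) simp
  fix g :: "complex \<Rightarrow> complex" and i :: nat and x :: real
  assume g: "g holomorphic_on B_nbhd \<rho>" "\<And>z. z \<in> B_nbhd \<rho> \<Longrightarrow> cmod (g z) \<le> C"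
    and i: "i \<le> n" and x: "x \<in> {0..1}"
  have "cmod ((deriv ^^ i) g (complex_of_real x)) \<le> fact i * C / (\<rho> / 2) ^ i"
    using higher_deriv_bound_unit_seg[OF g \<open>0 < \<rho>\<close> x] .
  also have "\<dots> \<le> \<bar>fact i * C / (\<rho> / 2) ^ i\<bar>" by (rule abs_ge_self)
  also have "\<dots> \<le> ?M"
    using i by (intro member_le_sum) auto
  finally show "cmod ((deriv ^^ i) g (complex_of_real x)) \<le> ?M" .
qed

text \<open>Normality supplies a large derivative at any chosen point of the subinterval, and
  iterated Landau converts it into a large value nearby. The set \<open>K\<close> is left general
  because it is used twice: with the unit segment to prove separation, and with a single point
  outside the interval to prove density.\<close>

lemma uniform_lower_bound_on_subintervals:
  assumes "0 < \<rho>" "0 < \<delta>" and K: "compact K" "K \<subseteq> B_nbhd \<rho>"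
  shows "\<exists>c E. 0 < c \<and> c \<le> 1 \<and> (\<forall>g a b. g holomorphic_on B_nbhd \<rho> \<longrightarrow>
    (\<forall>z\<in>B_nbhd \<rho>. cmod (g z) \<le> C) \<longrightarrow> (\<exists>z\<in>K. \<delta> \<le> cmod (g z)) \<longrightarrow> 0 \<le> a \<longrightarrow> a < b \<longrightarrow> b \<le> 1 \<longrightarrow>
    (\<exists>x\<in>{a..b}. (c * (b - a)) ^ E \<le> cmod (g (complex_of_real x))))"
proof -
  obtain n \<eta> where "0 < \<eta>" and n: "\<And>g x. g holomorphic_on B_nbhd \<rho> \<Longrightarrow>
      (\<forall>z\<in>B_nbhd \<rho>. cmod (g z) \<le> C) \<Longrightarrow> (\<exists>z\<in>K. \<delta> \<le> cmod (g z)) \<Longrightarrow> x \<in> {0..1} \<Longrightarrow>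
      (\<exists>j\<le>n. \<eta> \<le> cmod ((deriv ^^ j) g (complex_of_real x)))"
    using higher_deriv_lower_bound_by_normality[OF assms] by blast
  define \<kappa> where "\<kappa> = min \<eta> 1"
  obtain M where "0 \<le> M" and M: "\<And>g i x. g holomorphic_on B_nbhd \<rho> \<Longrightarrow>
      (\<And>z. z \<in> B_nbhd \<rho> \<Longrightarrow> cmod (g z) \<le> C) \<Longrightarrow> i \<le> Suc n \<Longrightarrow>
      x \<in> {0..1} \<Longrightarrow> cmod ((deriv ^^ i) g (complex_of_real x)) \<le> M"
    using higher_derivs_uniformly_bounded[OF \<open>0 < \<rho>\<close>, where C = C and n = "Suc n"] by metis
  have \<kappa>: "0 < \<kappa>" "\<kappa> \<le> 1" "\<kappa> \<le> \<eta>" using \<open>0 < \<eta>\<close> by (auto simp: \<kappa>_def)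
  define c where "c = \<kappa> / (4 + M)"
  have c: "0 < c" "c \<le> 1" using \<kappa> \<open>0 \<le> M\<close> by (auto simp: c_def divide_le_eq)
  moreover have "\<exists>x\<in>{a..b}. (c * (b - a)) ^ landau_exp n \<le> cmod (g (complex_of_real x))"
    if g: "g holomorphic_on B_nbhd \<rho>" "\<forall>z\<in>B_nbhd \<rho>. cmod (g z) \<le> C" "\<exists>z\<in>K. \<delta> \<le> cmod (g z)"
      and ab: "0 \<le> a" "a < b" "b \<le> 1" for g a b
  proof -
    obtain j where j: "j \<le> n" "\<eta> \<le> cmod ((deriv ^^ j) g (complex_of_real a))"
      using n[OF g, of a] ab by auto
    have "\<exists>y\<in>{a..b}. (\<kappa> * (b - a) / (4 + M)) ^ landau_exp j \<le> cmod (g (complex_of_real y))"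
    proof (rule iterated_Landau_lower_bound[OF g(1) \<open>0 < \<rho>\<close> _ ab, where x = a])
      show "cmod ((deriv ^^ i) g (complex_of_real x)) \<le> M" if "i \<le> Suc j" "x \<in> {0..1}" for i x
        using g that j by (intro M) auto
    qed (use ab j \<kappa> in auto)
    \<comment> \<open>The order \<open>j\<close> depends on \<open>g\<close> and \<open>a\<close>;
      as the base is at most 1, the exponent for the largest order works for all.\<close>
    moreover have "(c * (b - a)) ^ landau_exp n \<le> (c * (b - a)) ^ landau_exp j"
      using ab c landau_exp_mono[OF j(1)] by (intro power_decreasing) (auto intro: mult_le_one)
    ultimately show ?thesis by (force simp: c_def intro: order_trans)
  qed
  ultimately show ?thesis by blast
qed

section \<open>Nonlinearity of compositions\<close>

text \<open>Along the real line the complex derivative is a vector derivative of a real-valued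
  function. Its imaginary part is the derivative of the constant 0.\<close>

lemma real_derivative_of_real_on_reals:
  assumes F: "(F has_field_derivative D) (at (complex_of_real x))"
    and ev: "\<forall>\<^sub>F y in nhds x. F (complex_of_real y) = complex_of_real (f y)"
  shows "(f has_real_derivative Re D) (at x)" "D = complex_of_real (Re D)"
proof -
  have "((\<lambda>y. F (complex_of_real y)) has_vector_derivative D) (at x)"
    using F by (rule has_vector_derivative_real_field)
  then have vd: "((\<lambda>y. complex_of_real (f y)) has_vector_derivative D) (at x)"
    using has_vector_derivative_cong_ev[of UNIV "\<lambda>y. F (complex_of_real y)" "\<lambda>y. complex_of_real (f y)" x D]
      ev eventually_nhds_x_imp_x[OF ev] by simp
  have "((\<lambda>y. Re (complex_of_real (f y))) has_vector_derivative Re D) (at x)"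
    by (rule bounded_linear.has_vector_derivative[OF bounded_linear_Re vd])
  then show "(f has_real_derivative Re D) (at x)"
    by (simp add: has_real_derivative_iff_has_vector_derivative)
  have "((\<lambda>y. Im (complex_of_real (f y))) has_vector_derivative Im D) (at x)"
    by (rule bounded_linear.has_vector_derivative[OF bounded_linear_Im vd])
  then have "((\<lambda>y. 0) has_real_derivative Im D) (at x)"
    by (simp add: has_real_derivative_iff_has_vector_derivative)
  then have "Im D = 0" using DERIV_unique DERIV_const by blast
  then show "D = complex_of_real (Re D)" by (simp add: complex_eq_iff)
qed

text \<open>The pre-Schwarzian derivative, i.e. the logarithmic derivative of
  \<open>F'\<close>.\<close>

definition nonlin :: "(complex \<Rightarrow> complex) \<Rightarrow> complex \<Rightarrow> complex" where
  "nonlin F z = deriv (deriv F) z / deriv F z"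

text \<open>
  Words are read here with the innermost map first, i.e. reversed with respect to the words of
  the iterated function system.
\<close>

fun rev_comp :: "(nat \<Rightarrow> complex \<Rightarrow> complex) \<Rightarrow> nat list \<Rightarrow> complex \<Rightarrow> complex" where
  "rev_comp F [] z = z"
| "rev_comp F (k # w) z = rev_comp F w (F k z)"

text \<open>Given by the cocycle recursion and not as \<open>nonlin\<close> of the composition, so
  that bounds and perturbation estimates are inductions on the word. The link with the composition
  is \<open>deriv2_rev_comp\<close>.\<close>

fun word_nonlin :: "(nat \<Rightarrow> complex \<Rightarrow> complex) \<Rightarrow> nat list \<Rightarrow> complex \<Rightarrow> complex" where
  "word_nonlin F [] z = 0"
| "word_nonlin F (k # w) z = nonlin (F k) z + deriv (F k) z * word_nonlin F w (F k z)"

lemma rev_comp_Cons: "rev_comp F (k # w) = rev_comp F w \<circ> F k"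
  by (rule ext) simp

lemma rev_comp_append: "rev_comp F (v @ w) z = rev_comp F w (rev_comp F v z)"
  by (induction v arbitrary: z) auto

lemma comp_word_snoc: "comp_word \<Phi> (w @ [k]) x = comp_word \<Phi> w (\<Phi> k x)"
proof -
  have "foldr (\<lambda>i g. \<Phi> i \<circ> g) w h x = foldr (\<lambda>i g. \<Phi> i \<circ> g) w id (h x)" for h x
    by (induction w) auto
  then show ?thesis by (simp add: comp_word_def)
qed

text \<open>The single constant \<open>s\<close> makes the strict inequalities of the class
  quantitative on the compact closure: the margin of the images, the distance of the derivatives
  from 0 and from 1, and a bound for the second derivatives. \<open>analytic_ifs_exists\<close>
  provides it.\<close>

locale analytic_ifs =
  fixes \<epsilon> s :: real and N :: nat and \<Phi> :: "nat \<Rightarrow> real \<Rightarrow> real" and F :: "nat \<Rightarrow> complex \<Rightarrow> complex"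
  assumes eps_pos: "0 < \<epsilon>" and s_pos: "0 < s" and s_less_1: "s < 1"
    and hol: "k \<in> {1..N} \<Longrightarrow> F k holomorphic_on B_nbhd (2 * \<epsilon>)"
    and real_on_unit: "k \<in> {1..N} \<Longrightarrow> x \<in> {0..1} \<Longrightarrow> F k (complex_of_real x) = complex_of_real (\<Phi> k x)"
    and unit_maps: "k \<in> {1..N} \<Longrightarrow> x \<in> {0..1} \<Longrightarrow> \<Phi> k x \<in> {0..1}"
    and maps_margin: "k \<in> {1..N} \<Longrightarrow> z \<in> closure (B_nbhd \<epsilon>) \<Longrightarrow> F k z \<in> B_nbhd (\<epsilon> - s)"
    and deriv_ge: "k \<in> {1..N} \<Longrightarrow> z \<in> closure (B_nbhd \<epsilon>) \<Longrightarrow> s \<le> cmod (deriv (F k) z)"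
    and deriv_le: "k \<in> {1..N} \<Longrightarrow> z \<in> closure (B_nbhd \<epsilon>) \<Longrightarrow> cmod (deriv (F k) z) \<le> 1 - s"
    and deriv2_le: "k \<in> {1..N} \<Longrightarrow> z \<in> closure (B_nbhd \<epsilon>) \<Longrightarrow> cmod (deriv (deriv (F k)) z) \<le> 1 / s"
begin

lemma maps: "k \<in> {1..N} \<Longrightarrow> z \<in> closure (B_nbhd \<epsilon>) \<Longrightarrow> F k z \<in> B_nbhd \<epsilon>"
  using maps_margin[of k z] B_nbhd_mono[of "\<epsilon> - s" \<epsilon>] s_pos by auto

lemma B_subset: "B_nbhd \<epsilon> \<subseteq> B_nbhd (2 * \<epsilon>)"
  using eps_pos by (intro B_nbhd_mono) auto

lemma hol_B: "k \<in> {1..N} \<Longrightarrow> F k holomorphic_on B_nbhd \<epsilon>"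
  using hol B_subset by (rule holomorphic_on_subset)

lemma nonlin_le:
  assumes "k \<in> {1..N}" "z \<in> closure (B_nbhd \<epsilon>)"
  shows "cmod (nonlin (F k) z) \<le> 1 / s\<^sup>2"
proof -
  have "cmod (nonlin (F k) z) \<le> (1 / s) / s"
    unfolding nonlin_def norm_divide using deriv2_le[OF assms] deriv_ge[OF assms] s_pos
    by (intro frac_le) auto
  then show ?thesis by (simp add: power2_eq_square)
qed

text \<open>The bound \<open>1 / s ^ 3\<close> is the fixed point of
  \<open>X = 1 / s\<^sup>2 + (1 - s) * X\<close>, the estimate that the recursion yields; hence it
  does not depend on the length of the word.\<close>

lemma word_nonlin_le:
  assumes "set w \<subseteq> {1..N}" "z \<in> closure (B_nbhd \<epsilon>)"
  shows "cmod (word_nonlin F w z) \<le> 1 / s ^ 3"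
  using assms
proof (induction w arbitrary: z)
  case Nil
  then show ?case using s_pos by simp
next
  case (Cons k w)
  have k: "k \<in> {1..N}" using Cons.prems by auto
  have "cmod (word_nonlin F (k # w) z)
      \<le> cmod (nonlin (F k) z) + cmod (deriv (F k) z) * cmod (word_nonlin F w (F k z))"
    by (simp add: norm_mult[symmetric] norm_triangle_ineq)
  also have "\<dots> \<le> 1 / s\<^sup>2 + (1 - s) * (1 / s ^ 3)"
    using Cons.prems k s_less_1 closure_B_nbhd_mem[OF maps[OF k Cons.prems(2)]]
    by (intro add_mono mult_mono nonlin_le deriv_le Cons.IH) auto
  also have "\<dots> = 1 / s ^ 3"
    using s_pos by (simp add: field_simps power2_eq_square power3_eq_cube)
  finally show ?case .
qed

lemma nonlin_hol: "k \<in> {1..N} \<Longrightarrow> nonlin (F k) holomorphic_on B_nbhd \<epsilon>"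
  unfolding nonlin_def
  using deriv_ge[of k] s_pos
  by (intro holomorphic_intros hol_B open_B_nbhd holomorphic_deriv) (force dest: closure_B_nbhd_mem)+

lemma word_nonlin_hol: "set w \<subseteq> {1..N} \<Longrightarrow> word_nonlin F w holomorphic_on B_nbhd \<epsilon>"
proof (induction w)
  case Nil
  then show ?case by (simp add: word_nonlin.simps(1)[abs_def])
next
  case (Cons k w)
  have k: "k \<in> {1..N}" using Cons.prems by auto
  have "(word_nonlin F w \<circ> F k) holomorphic_on B_nbhd \<epsilon>"
    using Cons k maps closure_B_nbhd_mem by (intro holomorphic_on_compose_gen[OF hol_B, of k _ "B_nbhd \<epsilon>"]) auto
  then have "(\<lambda>z. nonlin (F k) z + deriv (F k) z * (word_nonlin F w \<circ> F k) z) holomorphic_on B_nbhd \<epsilon>"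
    by (intro holomorphic_intros nonlin_hol k holomorphic_deriv hol_B open_B_nbhd)
  moreover have "word_nonlin F (k # w) = (\<lambda>z. nonlin (F k) z + deriv (F k) z * (word_nonlin F w \<circ> F k) z)"
    by (rule ext) simp
  ultimately show ?case by simp
qed

lemma rev_comp_maps: "set w \<subseteq> {1..N} \<Longrightarrow> z \<in> B_nbhd \<epsilon> \<Longrightarrow> rev_comp F w z \<in> B_nbhd \<epsilon>"
proof (induction w arbitrary: z)
  case (Cons k w)
  then have "F k z \<in> B_nbhd \<epsilon>" by (intro maps closure_B_nbhd_mem) auto
  with Cons show ?case by auto
qed auto

lemma rev_comp_hol: "set w \<subseteq> {1..N} \<Longrightarrow> rev_comp F w holomorphic_on B_nbhd \<epsilon>"
proof (induction w)
  case Nil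
  then show ?case by (simp add: rev_comp.simps(1)[abs_def])
next
  case (Cons k w)
  have k: "k \<in> {1..N}" using Cons.prems by auto
  have "(rev_comp F w \<circ> F k) holomorphic_on B_nbhd \<epsilon>"
    using Cons k maps closure_B_nbhd_mem by (intro holomorphic_on_compose_gen[OF hol_B, of k _ "B_nbhd \<epsilon>"]) auto
  then show ?case by (simp add: o_def)
qed

lemma has_deriv_rev_comp:
  assumes "set (k # w) \<subseteq> {1..N}" "z \<in> B_nbhd \<epsilon>"
  shows "(rev_comp F (k # w) has_field_derivative
    deriv (rev_comp F w) (F k z) * deriv (F k) z) (at z)"
proof -
  have "F k z \<in> B_nbhd \<epsilon>" using assms by (intro maps closure_B_nbhd_mem) auto
  then have "(rev_comp F w has_field_derivative deriv (rev_comp F w) (F k z)) (at (F k z))"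
    using assms by (intro has_deriv_B_nbhd[OF rev_comp_hol]) auto
  from DERIV_chain[OF this has_deriv_B_nbhd[OF hol_B assms(2), of k]] show ?thesis
    using assms by (simp add: rev_comp_Cons)
qed

lemma deriv_rev_comp:
  assumes "set (k # w) \<subseteq> {1..N}" "z \<in> B_nbhd \<epsilon>"
  shows "deriv (rev_comp F (k # w)) z = deriv (rev_comp F w) (F k z) * deriv (F k) z"
  using has_deriv_rev_comp[OF assms] by (rule DERIV_imp_deriv)

lemma deriv_rev_comp_bounds:
  assumes "set w \<subseteq> {1..N}" "z \<in> B_nbhd \<epsilon>"
  shows "s ^ length w \<le> cmod (deriv (rev_comp F w) z)" "cmod (deriv (rev_comp F w) z) \<le> 1"
proof -
  have "s ^ length w \<le> cmod (deriv (rev_comp F w) z) \<and> cmod (deriv (rev_comp F w) z) \<le> 1"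
    using assms
  proof (induction w arbitrary: z)
    case Nil
    then show ?case by (simp add: rev_comp.simps(1)[abs_def])
  next
    case (Cons k w)
    have k: "k \<in> {1..N}" and w: "set w \<subseteq> {1..N}" and z: "z \<in> closure (B_nbhd \<epsilon>)"
      using Cons.prems closure_B_nbhd_mem by auto
    note IH = Cons.IH[OF w maps[OF k z]]
    have "s ^ length w * s \<le> cmod (deriv (rev_comp F w) (F k z)) * cmod (deriv (F k) z)"
      using IH deriv_ge[OF k z] s_pos by (intro mult_mono) auto
    moreover have "cmod (deriv (rev_comp F w) (F k z)) * cmod (deriv (F k) z) \<le> 1"
      using IH deriv_le[OF k z] s_pos by (intro mult_le_one) auto
    ultimately show ?case
      unfolding deriv_rev_comp[OF Cons.prems] by (simp add: norm_mult mult.commute)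
  qed
  then show "s ^ length w \<le> cmod (deriv (rev_comp F w) z)" "cmod (deriv (rev_comp F w) z) \<le> 1"
    by auto
qed

text \<open>The product form of the cocycle identity, obtained by differentiating the chain rule
  once more. It is the form that enters the Wronskian.\<close>

lemma deriv2_rev_comp:
  assumes "set w \<subseteq> {1..N}" "z \<in> B_nbhd \<epsilon>"
  shows "deriv (deriv (rev_comp F w)) z = deriv (rev_comp F w) z * word_nonlin F w z"
  using assms
proof (induction w arbitrary: z)
  case Nil
  then show ?case by (simp add: rev_comp.simps(1)[abs_def])
next
  case (Cons k w)
  have k: "k \<in> {1..N}" and w: "set w \<subseteq> {1..N}" and z: "z \<in> closure (B_nbhd \<epsilon>)"
    using Cons.prems closure_B_nbhd_mem by auto
  have nz: "deriv (F k) z \<noteq> 0" using deriv_ge[OF k z] s_pos by auto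
  have ev: "\<forall>\<^sub>F y in nhds z. deriv (rev_comp F (k # w)) y = deriv (rev_comp F w) (F k y) * deriv (F k) y"
    using eventually_nhds_in_open[OF open_B_nbhd Cons.prems(2)]
    by (rule eventually_mono) (rule deriv_rev_comp[OF Cons.prems(1)])
  have Fz: "F k z \<in> B_nbhd \<epsilon>" by (rule maps[OF k z])
  have 1: "((\<lambda>y. deriv (rev_comp F w) (F k y)) has_field_derivative
      deriv (deriv (rev_comp F w)) (F k z) * deriv (F k) z) (at z)"
    by (rule DERIV_chain2[OF has_deriv_B_nbhd[OF holomorphic_deriv[OF rev_comp_hol[OF w] open_B_nbhd] Fz]
          has_deriv_B_nbhd[OF hol_B[OF k] Cons.prems(2)]])
  have 2: "(deriv (F k) has_field_derivative deriv (deriv (F k)) z) (at z)"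
    by (rule has_deriv_B_nbhd[OF holomorphic_deriv[OF hol_B[OF k] open_B_nbhd] Cons.prems(2)])
  have "((\<lambda>y. deriv (rev_comp F w) (F k y) * deriv (F k) y) has_field_derivative
      (deriv (deriv (rev_comp F w)) (F k z) * deriv (F k) z) * deriv (F k) z +
      deriv (deriv (F k)) z * deriv (rev_comp F w) (F k z)) (at z)"
    by (rule DERIV_mult[OF 1 2])
  then have "deriv (deriv (rev_comp F (k # w))) z =
      (deriv (deriv (rev_comp F w)) (F k z) * deriv (F k) z) * deriv (F k) z +
      deriv (deriv (F k)) z * deriv (rev_comp F w) (F k z)"
    unfolding deriv_cong_ev[OF ev refl] by (rule DERIV_imp_deriv)
  then show ?case
    unfolding deriv_rev_comp[OF Cons.prems] Cons.IH[OF w Fz]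
    using nz by (simp add: nonlin_def field_simps del: rev_comp.simps)
qed

section \<open>Real compositions: invariance of the interval, expansion, continuity\<close>

lemma comp_word_unit: "set w \<subseteq> {1..N} \<Longrightarrow> x \<in> {0..1} \<Longrightarrow> comp_word \<Phi> (rev w) x \<in> {0..1}"
proof (induction w arbitrary: x)
  case (Cons k w)
  then have "\<Phi> k x \<in> {0..1}" by (intro unit_maps) auto
  with Cons.IH[of "\<Phi> k x"] Cons.prems show ?case by (simp add: comp_word_snoc)
qed (simp add: comp_word_def)

lemma rev_comp_of_real:
  "set w \<subseteq> {1..N} \<Longrightarrow> x \<in> {0..1} \<Longrightarrow>
    rev_comp F w (complex_of_real x) = complex_of_real (comp_word \<Phi> (rev w) x)"
proof (induction w arbitrary: x)
  case (Cons k w)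
  then have "\<Phi> k x \<in> {0..1}" "F k (complex_of_real x) = complex_of_real (\<Phi> k x)"
    by (intro unit_maps real_on_unit; auto)+
  with Cons.IH[of "\<Phi> k x"] Cons.prems show ?case by (simp add: comp_word_snoc)
qed (simp add: comp_word_def)

text \<open>A lower Lipschitz bound calls for the mean value theorem with equality, which is
  available for the real map only. At interior points its derivative is the complex one, which is
  real there and at least \<open>s\<close> in modulus.\<close>

lemma map_expansion_lower:
  assumes k: "k \<in> {1..N}" and xy: "x \<in> {0..1}" "y \<in> {0..1}"
  shows "s * \<bar>x - y\<bar> \<le> \<bar>\<Phi> k x - \<Phi> k y\<bar>"
proof -
  have less: "s * (y - x) \<le> \<bar>\<Phi> k y - \<Phi> k x\<bar>" if "0 \<le> x" "x < y" "y \<le> 1" for x y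
  proof -
    have "continuous_on unit_seg (F k)"
      using unit_seg_subset_B_nbhd[OF eps_pos]
      by (intro holomorphic_on_imp_continuous_on holomorphic_on_subset[OF hol_B[OF k]])
    then have "continuous_on {0..1} (\<lambda>x. F k (complex_of_real x))"
      by (rule continuous_on_compose2) (auto intro: continuous_on_of_real)
    then have "continuous_on {0..1} (\<lambda>x. Re (F k (complex_of_real x)))"
      by (rule continuous_on_Re)
    then have "continuous_on {0..1} (\<Phi> k)"
      by (rule continuous_on_eq) (simp only: real_on_unit[OF k] Re_complex_of_real)
    then have cont: "continuous_on {x..y} (\<Phi> k)"
      using that by (elim continuous_on_subset) auto
    have D: "(\<Phi> k has_real_derivative Re (deriv (F k) (complex_of_real t))) (at t)"
      and D': "deriv (F k) (complex_of_real t) = complex_of_real (Re (deriv (F k) (complex_of_real t)))"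
      if "t \<in> {0<..<1}" for t
    proof -
      have "(F k has_field_derivative deriv (F k) (complex_of_real t)) (at (complex_of_real t))"
        using that k eps_pos by (intro has_deriv_B_nbhd[OF hol_B] of_real_in_B_nbhd) auto
      moreover have "\<forall>\<^sub>F y in nhds t. F k (complex_of_real y) = complex_of_real (\<Phi> k y)"
        using eventually_nhds_in_open[OF open_greaterThanLessThan that]
        by (rule eventually_mono) (rule real_on_unit[OF k], simp)
      ultimately show "(\<Phi> k has_real_derivative Re (deriv (F k) (complex_of_real t))) (at t)"
        "deriv (F k) (complex_of_real t) = complex_of_real (Re (deriv (F k) (complex_of_real t)))"
        by (rule real_derivative_of_real_on_reals)+
    qed
    obtain t l where t: "x < t" "t < y" "(\<Phi> k has_real_derivative l) (at t)"
      "\<Phi> k y - \<Phi> k x = (y - x) * l"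
    proof -
      have "\<Phi> k differentiable (at t)" if "x < t" "t < y" for t
        using D[of t] that \<open>0 \<le> x\<close> \<open>y \<le> 1\<close> by (auto simp: real_differentiable_def)
      from MVT[OF \<open>x < y\<close> cont this] obtain l z where
        "x < z" "z < y" "(\<Phi> k has_real_derivative l) (at z)" "\<Phi> k y - \<Phi> k x = (y - x) * l"
        by blast
      then show ?thesis by (intro that)
    qed
    have "l = Re (deriv (F k) (complex_of_real t))"
      using t D[of t] that by (intro DERIV_unique[OF t(3)]) auto
    then have "\<bar>l\<bar> = cmod (deriv (F k) (complex_of_real t))"
    proof -
      have "t \<in> {0<..<1}" using t that by auto
      from D'[OF this] show ?thesis
        unfolding \<open>l = _\<close> by (metis norm_of_real)
    qed
    then have "s \<le> \<bar>l\<bar>"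
      using deriv_ge[OF k, of "complex_of_real t"] t that eps_pos
      by (simp add: closure_B_nbhd_mem of_real_in_B_nbhd)
    then show ?thesis
      using t that by (simp add: abs_mult mult.commute)
  qed
  show ?thesis
    using less[of x y] less[of y x] xy by (cases x y rule: linorder_cases) auto
qed

lemma comp_word_expansion_lower:
  "set w \<subseteq> {1..N} \<Longrightarrow> x \<in> {0..1} \<Longrightarrow> y \<in> {0..1} \<Longrightarrow>
    s ^ length w * \<bar>x - y\<bar> \<le> \<bar>comp_word \<Phi> (rev w) x - comp_word \<Phi> (rev w) y\<bar>"
proof (induction w arbitrary: x y)
  case Nil
  then show ?case by (simp add: comp_word_def)
next
  case (Cons k w)
  have k: "k \<in> {1..N}" using Cons.prems by auto
  have "s ^ length w * (s * \<bar>x - y\<bar>) \<le> s ^ length w * \<bar>\<Phi> k x - \<Phi> k y\<bar>"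
    using map_expansion_lower[OF k Cons.prems(2,3)] s_pos by (intro mult_left_mono) auto
  also have "\<dots> \<le> \<bar>comp_word \<Phi> (rev w) (\<Phi> k x) - comp_word \<Phi> (rev w) (\<Phi> k y)\<bar>"
    using Cons k by (intro Cons.IH unit_maps) auto
  finally show ?case by (simp add: comp_word_snoc mult_ac)
qed

lemma comp_word_continuous:
  assumes "set w \<subseteq> {1..N}"
  shows "continuous_on {0..1} (comp_word \<Phi> (rev w))"
proof -
  have "continuous_on unit_seg (rev_comp F w)"
    using unit_seg_subset_B_nbhd[OF eps_pos]
    by (intro holomorphic_on_imp_continuous_on holomorphic_on_subset[OF rev_comp_hol[OF assms]])
  then have "continuous_on {0..1} (\<lambda>x. rev_comp F w (complex_of_real x))"
    by (rule continuous_on_compose2) (auto intro: continuous_on_of_real)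
  then have "continuous_on {0..1} (\<lambda>x. Re (rev_comp F w (complex_of_real x)))"
    by (rule continuous_on_Re)
  then show ?thesis
    by (rule continuous_on_eq) (simp only: rev_comp_of_real[OF assms] Re_complex_of_real)
qed

end

section \<open>From a nonlinearity gap to separation\<close>

text \<open>The tails \<open>v\<close> and \<open>w\<close> are arbitrary, possibly empty and of
  different lengths; one \<open>\<delta>\<close> has to serve all of them.\<close>

definition nonlin_gap :: "nat \<Rightarrow> (nat \<Rightarrow> complex \<Rightarrow> complex) \<Rightarrow> real \<Rightarrow> bool" where
  "nonlin_gap N F \<delta> \<longleftrightarrow> 0 < \<delta> \<and> (\<forall>k\<in>{1..N}. \<forall>l\<in>{1..N}. k \<noteq> l \<longrightarrow>
    (\<forall>v w. set v \<subseteq> {1..N} \<longrightarrow> set w \<subseteq> {1..N} \<longrightarrow> (\<exists>x\<in>{0..1}.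
      \<delta> \<le> cmod (word_nonlin F (k # v) (complex_of_real x) - word_nonlin F (l # w) (complex_of_real x)))))"

context analytic_ifs
begin

lemma word_nonlin_diff_hol:
  assumes "set v \<subseteq> {1..N}" "set w \<subseteq> {1..N}"
  shows "(\<lambda>z. word_nonlin F v z - word_nonlin F w z) holomorphic_on B_nbhd \<epsilon>"
  using assms by (intro holomorphic_on_diff word_nonlin_hol)

lemma word_nonlin_diff_le:
  assumes "set v \<subseteq> {1..N}" "set w \<subseteq> {1..N}" "z \<in> B_nbhd \<epsilon>"
  shows "cmod (word_nonlin F v z - word_nonlin F w z) \<le> 2 / s ^ 3"
  using word_nonlin_le[OF assms(1) closure_B_nbhd_mem[OF assms(3)]]
    word_nonlin_le[OF assms(2) closure_B_nbhd_mem[OF assms(3)]]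
    norm_triangle_ineq4[of "word_nonlin F v z" "word_nonlin F w z"] by simp

text \<open>The interval between the images of 0 and 1 is covered by the intermediate value theorem
  and is long by the expansion bound. The minimum and maximum account for maps that reverse
  orientation.\<close>

lemma comp_word_covers_interval:
  assumes p: "set p \<subseteq> {1..N}"
  obtains a b where "0 \<le> a" "a < b" "b \<le> 1" "s ^ length p \<le> b - a"
    "\<And>y. y \<in> {a..b} \<Longrightarrow> \<exists>x\<in>{0..1}. comp_word \<Phi> (rev p) x = y"
proof -
  define f where "f = comp_word \<Phi> (rev p)"
  have f01: "f 0 \<in> {0..1}" "f 1 \<in> {0..1}"
    unfolding f_def by (intro comp_word_unit p; simp)+
  have "s ^ length p * \<bar>0 - 1\<bar> \<le> \<bar>f 0 - f 1\<bar>"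
    unfolding f_def by (intro comp_word_expansion_lower p) auto
  moreover have "0 < s ^ length p" using s_pos by simp
  ultimately have d: "0 < \<bar>f 0 - f 1\<bar>" "s ^ length p \<le> \<bar>f 0 - f 1\<bar>" by auto
  have cont: "continuous_on {0..1} f" unfolding f_def by (rule comp_word_continuous[OF p])
  have surj: "\<exists>x\<in>{0..1}. f x = y" if "y \<in> {min (f 0) (f 1)..max (f 0) (f 1)}" for y
  proof (cases "f 0 \<le> f 1")
    case True
    then show ?thesis using IVT'[of f 0 y 1] cont that by auto
  next
    case False
    then show ?thesis using IVT2'[of f 1 y 0] cont that by auto
  qed
  show ?thesis
    by (rule that[of "min (f 0) (f 1)" "max (f 0) (f 1)"])
      (use f01 d surj in \<open>auto simp: f_def[symmetric] min_def max_def\<close>)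
qed

text \<open>
  With \<open>h\<close> the difference of the compositions and \<open>D\<close>, \<open>D'\<close> their derivatives, the nonlinearity
  gap times \<open>D * D'\<close> is a Wronskian, linear in \<open>h'\<close> and \<open>h''\<close>.
\<close>

lemma rev_comp_diff_deriv_lower:
  assumes v: "set v \<subseteq> {1..N}" and w: "set w \<subseteq> {1..N}" and len: "length v \<le> n" "length w \<le> n"
    and z: "z \<in> B_nbhd \<epsilon>" and \<kappa>: "0 < \<kappa>" "\<kappa> \<le> cmod (word_nonlin F v z - word_nonlin F w z)"
  defines "h \<equiv> \<lambda>z. rev_comp F v z - rev_comp F w z"
  shows "\<exists>j\<in>{1, 2}. s ^ (2 * n) * \<kappa> * s ^ 3 / 2 \<le> cmod ((deriv ^^ j) h z)"
proof (rule ccontr)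
  define D where "D = deriv (rev_comp F v) z"
  define D' where "D' = deriv (rev_comp F w) z"
  have dh: "deriv h y = deriv (rev_comp F v) y - deriv (rev_comp F w) y" if "y \<in> B_nbhd \<epsilon>" for y
    unfolding h_def
    by (intro DERIV_imp_deriv DERIV_diff has_deriv_B_nbhd[OF rev_comp_hol that] v w)
  have "deriv (deriv h) z = deriv (\<lambda>y. deriv (rev_comp F v) y - deriv (rev_comp F w) y) z"
    using eventually_nhds_in_open[OF open_B_nbhd z]
    by (intro deriv_cong_ev) (auto elim: eventually_mono intro: dh)
  also have "\<dots> = deriv (deriv (rev_comp F v)) z - deriv (deriv (rev_comp F w)) z"
    by (intro DERIV_imp_deriv DERIV_diff has_deriv_B_nbhd[where \<rho> = \<epsilon>] holomorphic_deriv
        rev_comp_hol v w z open_B_nbhd)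
  finally have d2h: "deriv (deriv h) z = D * word_nonlin F v z - D' * word_nonlin F w z"
    unfolding deriv2_rev_comp[OF v z] deriv2_rev_comp[OF w z] D_def D'_def .
  have d1h: "deriv h z = D - D'" unfolding dh[OF z] D_def D'_def ..
  let ?\<kappa> = "s ^ (2 * n) * \<kappa> * s ^ 3 / 2"
  assume "\<not> ?thesis"
  then have small: "cmod (deriv h z) < ?\<kappa>" "cmod (deriv (deriv h) z) < ?\<kappa>"
    by (auto simp: numeral_2_eq_2 not_le)
  have "s ^ n \<le> s ^ length v" "s ^ n \<le> s ^ length w"
    using len s_pos s_less_1 by (intro power_decreasing; simp)+
  then have Db: "s ^ n \<le> cmod D" "s ^ n \<le> cmod D'" "cmod D' \<le> 1"
    using deriv_rev_comp_bounds[OF v z] deriv_rev_comp_bounds[OF w z]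
    unfolding D_def D'_def by linarith+
  \<comment> \<open>With \<open>h' = D - D'\<close> and \<open>h''\<close> as in \<open>d2h\<close>,
    the terms in \<open>D' * D' * word_nonlin F w z\<close> cancel.\<close>
  have "D * D' * (word_nonlin F v z - word_nonlin F w z) =
      deriv (deriv h) z * D' - deriv h z * (D' * word_nonlin F w z)"
    unfolding d1h d2h by (simp add: algebra_simps)
  then have "cmod D * cmod D' * cmod (word_nonlin F v z - word_nonlin F w z) \<le>
      cmod (deriv (deriv h) z * D') + cmod (deriv h z * (D' * word_nonlin F w z))"
    unfolding norm_mult[symmetric] by (simp add: norm_triangle_ineq4)
  also have "\<dots> = cmod (deriv (deriv h) z) * cmod D' + cmod (deriv h z) * (cmod D' * cmod (word_nonlin F w z))"
    by (simp add: norm_mult)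
  \<comment> \<open>The factor \<open>s ^ 3 / 2\<close> of the threshold absorbs the bound
    \<open>1 / s ^ 3\<close> for the nonlinearity, since
    \<open>(1 + 1 / s ^ 3) * s ^ 3 / 2 < 1\<close>.\<close>
  also have "\<dots> \<le> ?\<kappa> * 1 + ?\<kappa> * (1 * (1 / s ^ 3))"
    using small Db word_nonlin_le[OF w closure_B_nbhd_mem[OF z]] \<kappa> s_pos
    by (intro add_mono mult_mono) auto
  also have "\<dots> = s ^ (2 * n) * \<kappa> * (s ^ 3 + 1) / 2"
    using s_pos by (simp add: field_simps)
  also have "\<dots> < s ^ (2 * n) * \<kappa>"
  proof -
    have "s ^ 3 < 1" using s_pos s_less_1 by (simp add: power_less_one_iff)
    then have "s ^ (2 * n) * \<kappa> * (s ^ 3 + 1) < s ^ (2 * n) * \<kappa> * 2"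
      using s_pos \<kappa> by (intro mult_strict_left_mono) auto
    then show ?thesis by simp
  qed
  also have "\<dots> \<le> cmod D * cmod D' * cmod (word_nonlin F v z - word_nonlin F w z)"
  proof -
    have "s ^ (2 * n) = s ^ n * s ^ n" by (simp add: mult_2 power_add)
    also have "\<dots> \<le> cmod D * cmod D'" using Db s_pos by (intro mult_mono) auto
    finally show ?thesis using \<kappa> by (intro mult_mono) auto
  qed
  finally show False by simp
qed

theorem SESC_if_nonlin_gap:
  assumes gap: "nonlin_gap N F \<delta>"
  shows "SESC N \<Phi>"
proof -
  have "0 < \<delta>" using gap by (simp add: nonlin_gap_def)
  obtain c E where c: "0 < c" "c \<le> 1" and cE: "\<And>g a b. g holomorphic_on B_nbhd \<epsilon> \<Longrightarrow>
      \<forall>z\<in>B_nbhd \<epsilon>. cmod (g z) \<le> 2 / s ^ 3 \<Longrightarrow> \<exists>z\<in>unit_seg. \<delta> \<le> cmod (g z) \<Longrightarrow>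
      0 \<le> a \<Longrightarrow> a < b \<Longrightarrow> b \<le> 1 \<Longrightarrow> \<exists>x\<in>{a..b}. (c * (b - a)) ^ E \<le> cmod (g (complex_of_real x))"
    using uniform_lower_bound_on_subintervals[OF eps_pos \<open>0 < \<delta>\<close> compact_unit_seg
        unit_seg_subset_B_nbhd[OF eps_pos], of "2 / s ^ 3"] by blast
  \<comment> \<open>Two points of the neighbourhood differ by at most
    \<open>2 * (1 + \<epsilon>)\<close>. Order 3 is one more than the order \<open>j \<le> 2\<close>
    at which Landau starts.\<close>
  obtain M where "0 \<le> M" and M: "\<And>g i x. g holomorphic_on B_nbhd \<epsilon> \<Longrightarrow>
      (\<And>z. z \<in> B_nbhd \<epsilon> \<Longrightarrow> cmod (g z) \<le> 2 * (1 + \<epsilon>)) \<Longrightarrow> i \<le> 3 \<Longrightarrow> x \<in> {0..1} \<Longrightarrow>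
      cmod ((deriv ^^ i) g (complex_of_real x)) \<le> M"
    by (rule higher_derivs_uniformly_bounded[OF eps_pos, where C = "2 * (1 + \<epsilon>)" and n = 3]) blast
  \<comment> \<open>Three of the six factors \<open>s\<close> give \<open>s ^ (3 * n)\<close> in the
    \<open>n\<close>-th power: \<open>2 * n\<close> from the two derivatives in the Wronskian and
    \<open>n\<close> from the length of the interval. The factor \<open>(c * s) ^ E\<close> comes
    from the nonlinearity gap on that interval; the rest are the constants of the Wronskian and
    Landau steps.\<close>
  define C where "C = (s ^ 6 * (c * s) ^ E / (2 * (4 + M))) ^ landau_exp 2"
  have "0 < C" unfolding C_def using s_pos c \<open>0 \<le> M\<close> by simp
  moreover have "C ^ n \<le> (SUP x\<in>{0..1}. \<bar>comp_word \<Phi> u x - comp_word \<Phi> v x\<bar>)"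
    if uv: "u \<in> words N n" "v \<in> words N n" "u \<noteq> v" for n u v
  proof -
    have "rev u \<noteq> rev v" "length (rev u) = length (rev v)"
      using uv by (auto simp: words_def)
    \<comment> \<open>Reversal puts the innermost letters first, so the common prefix
      \<open>p\<close> is the common innermost part and \<open>k\<close>, \<open>l\<close> are the
      first letters that differ.\<close>
    from same_length_different[OF this] obtain p k u' l v' where kl: "k \<noteq> l"
      and eq: "rev u = p @ k # u'" "rev v = p @ l # v'" by auto
    have sets: "set (rev u) \<subseteq> {1..N}" "set (rev v) \<subseteq> {1..N}" and len: "length (rev u) = n" "length (rev v) = n"
      using uv by (auto simp: words_def)
    have p: "set p \<subseteq> {1..N}" and ku: "set (k # u') \<subseteq> {1..N}" and lv: "set (l # v') \<subseteq> {1..N}"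
      using sets unfolding eq by auto
    have le: "length p \<le> n" "length (k # u') \<le> n" "length (l # v') \<le> n" "1 \<le> n"
      using len unfolding eq by auto
    obtain a b where ab: "0 \<le> a" "a < b" "b \<le> 1" and sab: "s ^ length p \<le> b - a"
      and cover: "\<And>y. y \<in> {a..b} \<Longrightarrow> \<exists>x\<in>{0..1}. comp_word \<Phi> (rev p) x = y"
      using comp_word_covers_interval[OF p] by blast
    have "s ^ n \<le> s ^ length p"
      using le s_pos s_less_1 by (intro power_decreasing) auto
    then have snab: "s ^ n \<le> b - a" using sab by simp
    define \<kappa> where "\<kappa> = (c * s ^ n) ^ E"
    have "0 < \<kappa>" using c s_pos by (simp add: \<kappa>_def)
    have "c * s ^ n \<le> 1" using c s_pos s_less_1 by (intro mult_le_one power_le_one) auto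
    then have "\<kappa> \<le> 1" unfolding \<kappa>_def using c s_pos by (intro power_le_one) auto
    have "\<exists>x\<in>{a..b}. (c * (b - a)) ^ E \<le> cmod ((\<lambda>z. word_nonlin F (k # u') z - word_nonlin F (l # v') z) (complex_of_real x))"
    proof (rule cE[OF word_nonlin_diff_hol[OF ku lv] _ _ ab])
      show "\<forall>z\<in>B_nbhd \<epsilon>. cmod (word_nonlin F (k # u') z - word_nonlin F (l # v') z) \<le> 2 / s ^ 3"
        using word_nonlin_diff_le[OF ku lv] by blast
      have "\<exists>x\<in>{0..1}. \<delta> \<le> cmod (word_nonlin F (k # u') (complex_of_real x) - word_nonlin F (l # v') (complex_of_real x))"
        using gap ku lv kl unfolding nonlin_gap_def by simp
      then show "\<exists>z\<in>unit_seg. \<delta> \<le> cmod (word_nonlin F (k # u') z - word_nonlin F (l # v') z)"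
        by blast
    qed
    then obtain x where x: "x \<in> {a..b}" "(c * (b - a)) ^ E \<le>
        cmod (word_nonlin F (k # u') (complex_of_real x) - word_nonlin F (l # v') (complex_of_real x))"
      by blast
    have "\<kappa> \<le> (c * (b - a)) ^ E"
      unfolding \<kappa>_def using c s_pos snab by (intro power_mono mult_left_mono) auto
    then have \<kappa>x: "\<kappa> \<le> cmod (word_nonlin F (k # u') (complex_of_real x) - word_nonlin F (l # v') (complex_of_real x))"
      using x by simp
    define h where "h = (\<lambda>z. rev_comp F (k # u') z - rev_comp F (l # v') z)"
    define \<kappa>' where "\<kappa>' = s ^ (2 * n) * \<kappa> * s ^ 3 / 2"
    have "complex_of_real x \<in> B_nbhd \<epsilon>"
      using x ab eps_pos by (intro of_real_in_B_nbhd) auto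
    from rev_comp_diff_deriv_lower[OF ku lv le(2,3) this \<open>0 < \<kappa>\<close> \<kappa>x]
    obtain j where j: "j \<in> {1, 2}" "\<kappa>' \<le> cmod ((deriv ^^ j) h (complex_of_real x))"
      unfolding h_def \<kappa>'_def by blast
    have "0 < \<kappa>'" using \<open>0 < \<kappa>\<close> s_pos by (simp add: \<kappa>'_def)
    have "s ^ (2 * n) * \<kappa> * s ^ 3 \<le> 1"
      using \<open>0 < \<kappa>\<close> \<open>\<kappa> \<le> 1\<close> s_pos s_less_1 by (intro mult_le_one power_le_one) auto
    then have "\<kappa>' \<le> 1" by (simp add: \<kappa>'_def)
    have h_hol: "h holomorphic_on B_nbhd \<epsilon>"
      unfolding h_def by (intro holomorphic_on_diff rev_comp_hol ku lv)
    have h_le: "cmod (h z) \<le> 2 * (1 + \<epsilon>)" if "z \<in> B_nbhd \<epsilon>" for z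
      using norm_less_if_in_B_nbhd[OF rev_comp_maps[OF ku that]]
        norm_less_if_in_B_nbhd[OF rev_comp_maps[OF lv that]]
        norm_triangle_ineq4[of "rev_comp F (k # u') z" "rev_comp F (l # v') z"]
      unfolding h_def by simp
    define q where "q = \<kappa>' * (b - a) / (4 + M)"
    have "\<exists>y\<in>{a..b}. q ^ landau_exp j \<le> cmod (h (complex_of_real y))"
      unfolding q_def
    proof (rule iterated_Landau_lower_bound[OF h_hol eps_pos _ ab x(1) j(2) \<open>0 < \<kappa>'\<close> \<open>\<kappa>' \<le> 1\<close>])
      show "cmod ((deriv ^^ i) h (complex_of_real t)) \<le> M" if "i \<le> Suc j" "t \<in> {0..1}" for i t
        using that j by (intro M h_hol h_le) auto
    qed
    then obtain y where y: "y \<in> {a..b}" "q ^ landau_exp j \<le> cmod (h (complex_of_real y))"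
      by blast
    obtain t where t: "t \<in> {0..1}" "comp_word \<Phi> (rev p) t = y" using cover[OF y(1)] by blast
    have "cmod (h (complex_of_real y)) = \<bar>comp_word \<Phi> u t - comp_word \<Phi> v t\<bar>"
    proof -
      have "h (complex_of_real y) = rev_comp F (rev u) (complex_of_real t) - rev_comp F (rev v) (complex_of_real t)"
        unfolding h_def eq rev_comp_append rev_comp_of_real[OF p t(1)] t(2) ..
      also have "\<dots> = complex_of_real (comp_word \<Phi> u t - comp_word \<Phi> v t)"
        unfolding rev_comp_of_real[OF sets(1) t(1)] rev_comp_of_real[OF sets(2) t(1)] by simp
      finally show ?thesis by (simp only: norm_of_real)
    qed
    moreover have "C ^ n \<le> q ^ landau_exp j"
    proof -
      have q: "0 < q" "q \<le> 1"
      proof -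
        show "0 < q" using \<open>0 < \<kappa>'\<close> ab \<open>0 \<le> M\<close> by (simp add: q_def)
        have "\<kappa>' * (b - a) \<le> 1" using \<open>0 < \<kappa>'\<close> \<open>\<kappa>' \<le> 1\<close> ab by (intro mult_le_one) auto
        then show "q \<le> 1" using \<open>0 \<le> M\<close> by (simp add: q_def divide_le_eq)
      qed
      have "(s ^ 6 * (c * s) ^ E / (2 * (4 + M))) ^ n =
          s ^ (3 * n) * (c ^ n * s ^ n) ^ E * (s ^ 3 / (2 * (4 + M))) ^ n"
        by (simp add: power_mult_distrib power_divide power_mult[symmetric] mult_ac flip: power_add)
          (simp add: algebra_simps power_add)
      \<comment> \<open>Distinct words force \<open>1 \<le> n\<close>, so constants that occur only
        once and are at most 1 may be replaced by their \<open>n\<close>-th powers.\<close>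
      also have "\<dots> \<le> s ^ (3 * n) * (c * s ^ n) ^ E * (s ^ 3 / (2 * (4 + M)))"
      proof (intro mult_mono power_mono)
        show "c ^ n \<le> c" using power_decreasing[OF \<open>1 \<le> n\<close>, of c] c by simp
        have "s ^ 3 \<le> 1" using s_pos s_less_1 by (intro power_le_one) auto
        then have "s ^ 3 / (2 * (4 + M)) \<le> 1" using \<open>0 \<le> M\<close> by (simp add: divide_le_eq)
        then show "(s ^ 3 / (2 * (4 + M))) ^ n \<le> s ^ 3 / (2 * (4 + M))"
          using power_decreasing[OF \<open>1 \<le> n\<close>, of "s ^ 3 / (2 * (4 + M))"] \<open>0 \<le> M\<close> s_pos by simp
      qed (use c s_pos \<open>0 \<le> M\<close> in auto)
      also have "\<dots> = \<kappa>' * s ^ n / (4 + M)"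
      proof -
        have "s ^ (3 * n) = s ^ (2 * n) * s ^ n" by (simp flip: power_add)
        then show ?thesis by (simp add: \<kappa>'_def \<kappa>_def)
      qed
      also have "\<dots> \<le> q"
        unfolding q_def using snab \<open>0 < \<kappa>'\<close> \<open>0 \<le> M\<close> by (intro divide_right_mono mult_left_mono) auto
      finally have base: "(s ^ 6 * (c * s) ^ E / (2 * (4 + M))) ^ n \<le> q" .
      have "C ^ n = ((s ^ 6 * (c * s) ^ E / (2 * (4 + M))) ^ n) ^ landau_exp 2"
        unfolding C_def by (simp only: power_mult[symmetric] mult.commute)
      also have "\<dots> \<le> q ^ landau_exp 2"
        using base s_pos c \<open>0 \<le> M\<close> by (intro power_mono) auto
      also have "\<dots> \<le> q ^ landau_exp j"
        using q j by (intro power_decreasing landau_exp_mono) auto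
      finally show ?thesis .
    qed
    ultimately have "C ^ n \<le> \<bar>comp_word \<Phi> u t - comp_word \<Phi> v t\<bar>" using y by simp
    moreover have "\<bar>comp_word \<Phi> u t - comp_word \<Phi> v t\<bar> \<le> (SUP x\<in>{0..1}. \<bar>comp_word \<Phi> u x - comp_word \<Phi> v x\<bar>)"
    proof (intro cSUP_upper bdd_aboveI2 t)
      show "\<bar>comp_word \<Phi> u x - comp_word \<Phi> v x\<bar> \<le> 1" if "x \<in> {0..1}" for x
        using comp_word_unit[OF sets(1) that] comp_word_unit[OF sets(2) that] by (simp add: abs_le_iff)
    qed
    ultimately show ?thesis by simp
  qed
  ultimately show ?thesis unfolding SESC_def by blast
qed

end

section \<open>Stability of the nonlinearity under perturbation\<close>

text \<open>Exposes the witness hidden in \<open>S_omega\<close>, because nonlinearities are taken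
  of the complex extension.\<close>

definition analytic_ext :: "real \<Rightarrow> (real \<Rightarrow> real) \<Rightarrow> (complex \<Rightarrow> complex) \<Rightarrow> bool" where
  "analytic_ext \<epsilon> f F \<longleftrightarrow> F analytic_on B_nbhd (2 * \<epsilon>) \<and>
      (\<forall>x::real. complex_of_real x \<in> B_nbhd (2 * \<epsilon>) \<longrightarrow>
         F (complex_of_real x) = complex_of_real (f x)) \<and>
      f ` {0..1} \<subseteq> {0..1} \<and>
      F ` closure (B_nbhd \<epsilon>) \<subseteq> B_nbhd \<epsilon> \<and>
      (\<forall>z\<in>closure (B_nbhd \<epsilon>). 0 < cmod (deriv F z) \<and> cmod (deriv F z) < 1)"

lemma S_omega_iff: "f \<in> S_omega \<epsilon> \<longleftrightarrow> (\<exists>F. analytic_ext \<epsilon> f F)"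
  by (simp add: S_omega_def analytic_ext_def)

lemma analytic_ext_hol: "analytic_ext \<epsilon> f F \<Longrightarrow> F holomorphic_on B_nbhd (2 * \<epsilon>)"
  unfolding analytic_ext_def by (blast intro: analytic_imp_holomorphic)

text \<open>All margins are collected into one continuous positive function \<open>m\<close>, which
  attains a positive minimum on the compact closure. The term
  \<open>1 / (1 + cmod (deriv (deriv F) z))\<close> encodes an upper bound as a lower one.\<close>

lemma analytic_ext_uniform:
  assumes "0 < \<epsilon>" and ext: "analytic_ext \<epsilon> f F"
  shows "\<exists>s>0. \<forall>z\<in>closure (B_nbhd \<epsilon>). s \<le> cmod (deriv F z) \<and> cmod (deriv F z) \<le> 1 - s \<and>
    cmod (deriv (deriv F) z) \<le> 1 / s \<and> F z \<in> B_nbhd (\<epsilon> - s)"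
proof -
  let ?K = "closure (B_nbhd \<epsilon>)"
  define m where "m = (\<lambda>z. min (min (cmod (deriv F z)) (1 - cmod (deriv F z)))
    (min (1 / (1 + cmod (deriv (deriv F) z))) (\<epsilon> - infdist (F z) unit_seg)))"
  note hol = analytic_ext_hol[OF ext]
  have sub: "?K \<subseteq> B_nbhd (2 * \<epsilon>)"
    using \<open>0 < \<epsilon>\<close> by (intro closure_B_nbhd_subset_B_nbhd) auto
  have cont: "continuous_on ?K F" "continuous_on ?K (deriv F)" "continuous_on ?K (deriv (deriv F))"
    using hol sub open_B_nbhd holomorphic_deriv holomorphic_on_imp_continuous_on
    by (meson continuous_on_subset)+
  have "continuous_on ?K m"
    unfolding m_def
    by (intro continuous_intros cont) (metis add_pos_nonneg less_numeral_extra(1,3) norm_ge_zero)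
  moreover have "?K \<noteq> {}"
    using of_real_in_B_nbhd[of 0 \<epsilon>] \<open>0 < \<epsilon>\<close> closure_subset by fastforce
  ultimately obtain w where w: "w \<in> ?K" "\<And>z. z \<in> ?K \<Longrightarrow> m w \<le> m z"
    using continuous_attains_inf[OF compact_closure_B_nbhd] by metis
  have pos: "0 < m z" if "z \<in> ?K" for z
  proof -
    have "F z \<in> B_nbhd \<epsilon>" "0 < cmod (deriv F z)" "cmod (deriv F z) < 1"
      using ext that unfolding analytic_ext_def by auto
    then show ?thesis by (simp add: m_def B_nbhd_eq_infdist add_pos_nonneg)
  qed
  define s where "s = m w / 2"
  have "0 < s" using pos[OF w(1)] by (simp add: s_def)
  moreover have "s \<le> cmod (deriv F z) \<and> cmod (deriv F z) \<le> 1 - s \<and>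
      cmod (deriv (deriv F) z) \<le> 1 / s \<and> F z \<in> B_nbhd (\<epsilon> - s)" if "z \<in> ?K" for z
  proof -
    have "s < m z" using w(2)[OF that] \<open>0 < s\<close> by (simp add: s_def)
    then have 1: "s < cmod (deriv F z)" "s < 1 - cmod (deriv F z)"
      "s < 1 / (1 + cmod (deriv (deriv F) z))" "s < \<epsilon> - infdist (F z) unit_seg"
      by (auto simp: m_def)
    have "s * (1 + cmod (deriv (deriv F) z)) < 1"
      using 1(3) by (simp add: less_divide_eq add_pos_nonneg)
    then have "cmod (deriv (deriv F) z) * s \<le> 1"
      using \<open>0 < s\<close> by (simp add: algebra_simps)
    then have "cmod (deriv (deriv F) z) \<le> 1 / s"
      using \<open>0 < s\<close> by (simp add: le_divide_eq)
    then show ?thesis using 1 by (simp add: B_nbhd_eq_infdist)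
  qed
  ultimately show ?thesis by blast
qed

lemma analytic_ifs_exists:
  assumes "0 < \<epsilon>" and ext: "\<And>k. k \<in> {1..N} \<Longrightarrow> analytic_ext \<epsilon> (\<Phi> k) (F k)"
  shows "\<exists>s. analytic_ifs \<epsilon> s N \<Phi> F"
proof -
  have "\<forall>k\<in>{1..N}. \<exists>s>0. \<forall>z\<in>closure (B_nbhd \<epsilon>). s \<le> cmod (deriv (F k) z) \<and>
      cmod (deriv (F k) z) \<le> 1 - s \<and> cmod (deriv (deriv (F k)) z) \<le> 1 / s \<and> F k z \<in> B_nbhd (\<epsilon> - s)"
    using analytic_ext_uniform[OF assms(1) ext] by blast
  from bchoice[OF this] obtain t where t': "\<forall>k\<in>{1..N}. 0 < t k \<and> (\<forall>z\<in>closure (B_nbhd \<epsilon>).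
      t k \<le> cmod (deriv (F k) z) \<and> cmod (deriv (F k) z) \<le> 1 - t k \<and>
      cmod (deriv (deriv (F k)) z) \<le> 1 / t k \<and> F k z \<in> B_nbhd (\<epsilon> - t k))" ..
  then have t: "\<And>k. k \<in> {1..N} \<Longrightarrow> 0 < t k"
    "\<And>k z. k \<in> {1..N} \<Longrightarrow> z \<in> closure (B_nbhd \<epsilon>) \<Longrightarrow> t k \<le> cmod (deriv (F k) z) \<and>
      cmod (deriv (F k) z) \<le> 1 - t k \<and> cmod (deriv (deriv (F k)) z) \<le> 1 / t k \<and> F k z \<in> B_nbhd (\<epsilon> - t k)"
    by blast+
  \<comment> \<open>The extra \<open>1 / 2\<close> keeps the set nonempty and ensures
    \<open>s < 1\<close>.\<close>
  define s where "s = Min (insert (1 / 2) (t ` {1..N}))"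
  have s: "0 < s" "s < 1" unfolding s_def using t by (auto simp: Min_less_iff intro!: exI[of _ "1 / 2"])
  have st: "s \<le> t k" if "k \<in> {1..N}" for k unfolding s_def using that by (intro Min_le) auto
  have "analytic_ifs \<epsilon> s N \<Phi> F"
  proof
    fix k assume k: "k \<in> {1..N}"
    show "F k holomorphic_on B_nbhd (2 * \<epsilon>)" by (rule analytic_ext_hol[OF ext[OF k]])
    fix x :: real assume x: "x \<in> {0..1}"
    show "F k (complex_of_real x) = complex_of_real (\<Phi> k x)"
      using ext[OF k] of_real_in_B_nbhd[OF x, of "2 * \<epsilon>"] \<open>0 < \<epsilon>\<close> unfolding analytic_ext_def by simp
    show "\<Phi> k x \<in> {0..1}" using ext[OF k] x unfolding analytic_ext_def by blast
  next
    fix k z assume k: "k \<in> {1..N}" and z: "z \<in> closure (B_nbhd \<epsilon>)"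
    have "1 / t k \<le> 1 / s" using st[OF k] s by (intro divide_left_mono) auto
    then show "F k z \<in> B_nbhd (\<epsilon> - s)" "s \<le> cmod (deriv (F k) z)" "cmod (deriv (F k) z) \<le> 1 - s"
      "cmod (deriv (deriv (F k)) z) \<le> 1 / s"
      using t(2)[OF k z] st[OF k] B_nbhd_mono[of "\<epsilon> - t k" "\<epsilon> - s"] by auto
  qed (use s \<open>0 < \<epsilon>\<close> in auto)
  then show ?thesis ..
qed

text \<open>The bridge from \<open>d2\<close>, which is stated with real derivatives, to the complex
  estimates. The first identity is needed on a whole real neighbourhood before it can be
  differentiated again.\<close>

lemma analytic_ext_deriv:
  assumes ext: "analytic_ext \<epsilon> f F" and x: "complex_of_real x \<in> B_nbhd (2 * \<epsilon>)"
  shows "deriv F (complex_of_real x) = complex_of_real (deriv f x)"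
    "deriv (deriv F) (complex_of_real x) = complex_of_real (deriv (deriv f) x)"
proof -
  have ev: "\<forall>\<^sub>F y in nhds x. complex_of_real y \<in> B_nbhd (2 * \<epsilon>)"
    if "complex_of_real x \<in> B_nbhd (2 * \<epsilon>)" for x
  proof -
    have "open (complex_of_real -` B_nbhd (2 * \<epsilon>))"
      by (intro open_vimage open_B_nbhd continuous_intros)
    from eventually_nhds_in_open[OF this, of x] show ?thesis using that by simp
  qed
  have 1: "deriv F (complex_of_real y) = complex_of_real (deriv f y)"
    if y: "complex_of_real y \<in> B_nbhd (2 * \<epsilon>)" for y
  proof -
    have "\<forall>\<^sub>F t in nhds y. F (complex_of_real t) = complex_of_real (f t)"
      using ev[OF y] ext unfolding analytic_ext_def by (auto elim: eventually_mono)
    note r = real_derivative_of_real_on_reals[OF has_deriv_B_nbhd[OF analytic_ext_hol[OF ext] y] this]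
    show ?thesis using r(2) DERIV_imp_deriv[OF r(1)] by simp
  qed
  show "deriv F (complex_of_real x) = complex_of_real (deriv f x)" by (rule 1[OF x])
  have "\<forall>\<^sub>F t in nhds x. deriv F (complex_of_real t) = complex_of_real (deriv f t)"
    using ev[OF x] 1 by (auto elim: eventually_mono)
  note r = real_derivative_of_real_on_reals[OF has_deriv_B_nbhd[OF
        holomorphic_deriv[OF analytic_ext_hol[OF ext] open_B_nbhd] x] this]
  show "deriv (deriv F) (complex_of_real x) = complex_of_real (deriv (deriv f) x)"
    using r(2) DERIV_imp_deriv[OF r(1)] by simp
qed

section \<open>The C2 distance in terms of the extensions\<close>

context
  fixes \<epsilon> f F g G
  assumes eps: "0 < \<epsilon>" and ext: "analytic_ext \<epsilon> f F" "analytic_ext \<epsilon> g G"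
begin

lemma analytic_ext_diff_eqs:
  assumes "x \<in> {0..1}"
  shows "cmod (F (complex_of_real x) - G (complex_of_real x)) = \<bar>f x - g x\<bar>"
    "cmod (deriv F (complex_of_real x) - deriv G (complex_of_real x)) = \<bar>deriv f x - deriv g x\<bar>"
    "cmod (deriv (deriv F) (complex_of_real x) - deriv (deriv G) (complex_of_real x))
      = \<bar>deriv (deriv f) x - deriv (deriv g) x\<bar>"
proof -
  have x: "complex_of_real x \<in> B_nbhd (2 * \<epsilon>)"
    using assms eps by (intro of_real_in_B_nbhd) auto
  then have "F (complex_of_real x) = complex_of_real (f x)" "G (complex_of_real x) = complex_of_real (g x)"
    using ext unfolding analytic_ext_def by auto
  then show "cmod (F (complex_of_real x) - G (complex_of_real x)) = \<bar>f x - g x\<bar>"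
    "cmod (deriv F (complex_of_real x) - deriv G (complex_of_real x)) = \<bar>deriv f x - deriv g x\<bar>"
    "cmod (deriv (deriv F) (complex_of_real x) - deriv (deriv G) (complex_of_real x))
      = \<bar>deriv (deriv f) x - deriv (deriv g) x\<bar>"
    unfolding analytic_ext_deriv[OF ext(1) x] analytic_ext_deriv[OF ext(2) x]
    by (simp_all flip: of_real_diff)
qed

lemma bdd_above_hol_diff:
  assumes "A holomorphic_on B_nbhd (2 * \<epsilon>)" "B holomorphic_on B_nbhd (2 * \<epsilon>)"
  shows "bdd_above ((\<lambda>x. cmod (A (complex_of_real x) - B (complex_of_real x))) ` {0..1})"
proof -
  have "continuous_on unit_seg A" "continuous_on unit_seg B"
    using assms unit_seg_subset_B_nbhd[of "2 * \<epsilon>"] eps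
    by (auto intro: holomorphic_on_imp_continuous_on holomorphic_on_subset)
  then have "continuous_on unit_seg (\<lambda>z. cmod (A z - B z))"
    by (intro continuous_intros)
  then have "compact ((\<lambda>z. cmod (A z - B z)) ` unit_seg)"
    using compact_unit_seg by (rule compact_continuous_image)
  then show ?thesis
    by (simp add: image_image bounded_imp_bdd_above compact_imp_bounded)
qed

text \<open>Continuity on the compact segment bounds the three families above. Only then does each
  supremum dominate its values; as all three are nonnegative, each is at most their sum.\<close>

lemma d2_lessD:
  assumes "d2 f g < r" "x \<in> {0..1}"
  shows "cmod (F (complex_of_real x) - G (complex_of_real x)) < r"
    "cmod (deriv F (complex_of_real x) - deriv G (complex_of_real x)) < r"
    "cmod (deriv (deriv F) (complex_of_real x) - deriv (deriv G) (complex_of_real x)) < r"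
proof -
  have hol: "F holomorphic_on B_nbhd (2 * \<epsilon>)" "G holomorphic_on B_nbhd (2 * \<epsilon>)"
    "deriv F holomorphic_on B_nbhd (2 * \<epsilon>)" "deriv G holomorphic_on B_nbhd (2 * \<epsilon>)"
    "deriv (deriv F) holomorphic_on B_nbhd (2 * \<epsilon>)" "deriv (deriv G) holomorphic_on B_nbhd (2 * \<epsilon>)"
    by (intro holomorphic_deriv open_B_nbhd analytic_ext_hol[OF ext(1)] analytic_ext_hol[OF ext(2)])+
  have up: "h x \<le> (SUP x\<in>{0..1}. h x)" "0 \<le> (SUP x\<in>{0..1}. h x)"
    if "bdd_above (h ` {0..1})" "\<And>x. 0 \<le> h x" for h :: "real \<Rightarrow> real"
  proof -
    show *: "h x \<le> (SUP x\<in>{0..1}. h x)" by (intro cSUP_upper that assms)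
    show "0 \<le> (SUP x\<in>{0..1}. h x)" by (rule order_trans[OF that(2) *])
  qed
  have bdd1: "bdd_above ((\<lambda>x. \<bar>f x - g x\<bar>) ` {0..1})"
    by (rule back_subst[of bdd_above, OF bdd_above_hol_diff[OF hol(1,2)]
          image_cong[OF refl analytic_ext_diff_eqs(1)]])
  have bdd2: "bdd_above ((\<lambda>x. \<bar>deriv f x - deriv g x\<bar>) ` {0..1})"
    by (rule back_subst[of bdd_above, OF bdd_above_hol_diff[OF hol(3,4)]
          image_cong[OF refl analytic_ext_diff_eqs(2)]])
  have bdd3: "bdd_above ((\<lambda>x. \<bar>deriv (deriv f) x - deriv (deriv g) x\<bar>) ` {0..1})"
    by (rule back_subst[of bdd_above, OF bdd_above_hol_diff[OF hol(5,6)]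
          image_cong[OF refl analytic_ext_diff_eqs(3)]])
  note * = up[OF bdd1 abs_ge_zero] up[OF bdd2 abs_ge_zero] up[OF bdd3 abs_ge_zero]
  show "cmod (F (complex_of_real x) - G (complex_of_real x)) < r"
    "cmod (deriv F (complex_of_real x) - deriv G (complex_of_real x)) < r"
    "cmod (deriv (deriv F) (complex_of_real x) - deriv (deriv G) (complex_of_real x)) < r"
    unfolding analytic_ext_diff_eqs[OF assms(2)]
    using assms(1) * unfolding d2_def by linarith+
qed

lemma d2_le:
  assumes "\<And>x. x \<in> {0..1} \<Longrightarrow> cmod (F (complex_of_real x) - G (complex_of_real x)) \<le> r"
    "\<And>x. x \<in> {0..1} \<Longrightarrow> cmod (deriv F (complex_of_real x) - deriv G (complex_of_real x)) \<le> r"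
    "\<And>x. x \<in> {0..1} \<Longrightarrow>
      cmod (deriv (deriv F) (complex_of_real x) - deriv (deriv G) (complex_of_real x)) \<le> r"
  shows "d2 f g \<le> 3 * r"
proof -
  have "(SUP x\<in>{0..1}. \<bar>f x - g x\<bar>) \<le> r" "(SUP x\<in>{0..1}. \<bar>deriv f x - deriv g x\<bar>) \<le> r"
    "(SUP x\<in>{0..1}. \<bar>deriv (deriv f) x - deriv (deriv g) x\<bar>) \<le> r"
    using assms by (intro cSUP_least; simp add: analytic_ext_diff_eqs)+
  then show ?thesis by (simp add: d2_def)
qed

end

context analytic_ifs
begin

text \<open>The error of a word is estimated by a contraction with factor \<open>1 - s / 2\<close>.
  Per letter, \<open>4 / s ^ 3\<close> comes from the change of \<open>nonlin\<close>,
  \<open>1 / s ^ 3\<close> from the change of the derivative in front, and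
  \<open>2 / (s ^ 3 * \<epsilon>)\<close> from the change of the argument. As \<open>G\<close> is
  controlled on the unit interval only, the argument is moved inside the nonlinearity of
  \<open>F\<close>, whose Lipschitz constant is known, and that of \<open>G\<close> is evaluated at
  real points alone.\<close>

lemma word_nonlin_perturb:
  assumes r: "0 \<le> r" "r \<le> s / 2"
    and G: "\<And>k x. k \<in> {1..N} \<Longrightarrow> x \<in> {0..1} \<Longrightarrow> G k (complex_of_real x) = complex_of_real (\<Psi> k x)"
    and \<Psi>: "\<And>k x. k \<in> {1..N} \<Longrightarrow> x \<in> {0..1} \<Longrightarrow> \<Psi> k x \<in> {0..1}"
    and near: "\<And>k x. k \<in> {1..N} \<Longrightarrow> x \<in> {0..1} \<Longrightarrow> cmod (F k (complex_of_real x) - G k (complex_of_real x)) \<le> r"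
      "\<And>k x. k \<in> {1..N} \<Longrightarrow> x \<in> {0..1} \<Longrightarrow>
        cmod (deriv (F k) (complex_of_real x) - deriv (G k) (complex_of_real x)) \<le> r"
      "\<And>k x. k \<in> {1..N} \<Longrightarrow> x \<in> {0..1} \<Longrightarrow>
        cmod (deriv (deriv (F k)) (complex_of_real x) - deriv (deriv (G k)) (complex_of_real x)) \<le> r"
    and "set w \<subseteq> {1..N}" "x \<in> {0..1}"
  shows "cmod (word_nonlin F w (complex_of_real x) - word_nonlin G w (complex_of_real x))
    \<le> 2 / s * (5 / s ^ 3 + 2 / (s ^ 3 * \<epsilon>)) * r" (is "_ \<le> ?D")
  using assms(8,9)
proof (induction w arbitrary: x)
  case Nil
  then show ?case using s_pos eps_pos r by simp
next
  case (Cons k w)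
  let ?x = "complex_of_real x"
  have k: "k \<in> {1..N}" and w: "set w \<subseteq> {1..N}" using Cons.prems by auto
  have xB: "?x \<in> B_nbhd \<epsilon>" by (rule of_real_in_B_nbhd[OF Cons.prems(2) eps_pos])
  then have xK: "?x \<in> closure (B_nbhd \<epsilon>)" by (rule closure_B_nbhd_mem)
  note near' = near[OF k Cons.prems(2)]
  define a where "a = deriv (F k) ?x"
  define b where "b = deriv (G k) ?x"
  define a' where "a' = deriv (deriv (F k)) ?x"
  define b' where "b' = deriv (deriv (G k)) ?x"
  have ab: "cmod (a - b) \<le> r" "cmod (a' - b') \<le> r" using near' by (auto simp: a_def b_def a'_def b'_def)
  have a: "s \<le> cmod a" "cmod a \<le> 1 - s" "cmod a' \<le> 1 / s"
    unfolding a_def a'_def using deriv_ge[OF k xK] deriv_le[OF k xK] deriv2_le[OF k xK] by auto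
  have b: "s / 2 \<le> cmod b" "cmod b \<le> 1 - s / 2"
    using a ab r norm_triangle_ineq2[of a b] norm_triangle_ineq3[of a b] by linarith+
  have "a \<noteq> 0" "b \<noteq> 0" using a b s_pos by auto
  have s3: "s ^ 3 \<le> s" using s_pos s_less_1 power_decreasing[of 1 3 s] by simp
  have t1: "cmod (nonlin (F k) ?x - nonlin (G k) ?x) \<le> 4 / s ^ 3 * r"
  proof -
    have "nonlin (F k) ?x - nonlin (G k) ?x = - (a' * (a - b) / (a * b)) + (a' - b') / b"
      using \<open>a \<noteq> 0\<close> \<open>b \<noteq> 0\<close> unfolding nonlin_def a_def[symmetric] b_def[symmetric] a'_def[symmetric] b'_def[symmetric]
      by (simp add: field_simps)
    then have "cmod (nonlin (F k) ?x - nonlin (G k) ?x)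
        \<le> cmod a' * cmod (a - b) / (cmod a * cmod b) + cmod (a' - b') / cmod b"
      using norm_triangle_ineq[of "- (a' * (a - b) / (a * b))" "(a' - b') / b"]
      by (simp only: norm_minus_cancel norm_divide norm_mult)
    also have "\<dots> \<le> 1 / s * r / (s * (s / 2)) + r / (s / 2)"
      using a b ab s_pos r by (intro add_mono frac_le mult_mono) auto
    also have "\<dots> = 2 / s ^ 3 * r + 2 / s * r" using s_pos by (simp add: field_simps power3_eq_cube)
    also have "\<dots> \<le> 2 / s ^ 3 * r + 2 / s ^ 3 * r"
      using s3 s_pos r by (intro add_mono mult_right_mono divide_left_mono) auto
    finally show ?thesis by simp
  qed
  have Fk: "F k ?x = complex_of_real (\<Phi> k x)" "\<Phi> k x \<in> {0..1}"
    using real_on_unit[OF k Cons.prems(2)] unit_maps[OF k Cons.prems(2)] by auto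
  have Gk: "G k ?x = complex_of_real (\<Psi> k x)" "\<Psi> k x \<in> {0..1}"
    using G[OF k Cons.prems(2)] \<Psi>[OF k Cons.prems(2)] by auto
  have t2: "cmod ((a - b) * word_nonlin F w (F k ?x)) \<le> r * (1 / s ^ 3)"
    unfolding norm_mult using ab word_nonlin_le[OF w closure_B_nbhd_mem[OF maps[OF k xK]]] r
    by (intro mult_mono) auto
  have t3: "cmod (b * (word_nonlin F w (F k ?x) - word_nonlin F w (G k ?x))) \<le> 1 * (2 / (s ^ 3 * \<epsilon>) * r)"
    unfolding norm_mult
  proof (intro mult_mono)
    show "cmod b \<le> 1" using b s_pos by simp
    have "cmod (word_nonlin F w (F k ?x) - word_nonlin F w (G k ?x))
        \<le> fact (Suc 0) * (1 / s ^ 3) / (\<epsilon> / 2) ^ Suc 0 * \<bar>\<Phi> k x - \<Psi> k x\<bar>"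
      unfolding Fk Gk
      using higher_deriv_lipschitz_unit_seg[OF word_nonlin_hol[OF w], of "1 / s ^ 3" "\<Phi> k x" "\<Psi> k x" 0]
        word_nonlin_le[OF w closure_B_nbhd_mem] Fk Gk eps_pos by simp
    also have "\<dots> = 2 / (s ^ 3 * \<epsilon>) * \<bar>\<Phi> k x - \<Psi> k x\<bar>" by (simp add: field_simps)
    also have "\<dots> \<le> 2 / (s ^ 3 * \<epsilon>) * r"
    proof -
      have "\<bar>\<Phi> k x - \<Psi> k x\<bar> \<le> r" using near'(1) unfolding Fk Gk by (simp flip: of_real_diff)
      then show ?thesis using s_pos eps_pos by (intro mult_left_mono) auto
    qed
    finally show "cmod (word_nonlin F w (F k ?x) - word_nonlin F w (G k ?x)) \<le> 2 / (s ^ 3 * \<epsilon>) * r" .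
  qed auto
  have t4: "cmod (b * (word_nonlin F w (G k ?x) - word_nonlin G w (G k ?x))) \<le> (1 - s / 2) * ?D"
    unfolding norm_mult Gk using b Cons.IH[OF w Gk(2)] s_less_1 by (intro mult_mono) auto
  have "word_nonlin F (k # w) ?x - word_nonlin G (k # w) ?x =
      ((nonlin (F k) ?x - nonlin (G k) ?x) + (a - b) * word_nonlin F w (F k ?x)) +
      (b * (word_nonlin F w (F k ?x) - word_nonlin F w (G k ?x)) +
       b * (word_nonlin F w (G k ?x) - word_nonlin G w (G k ?x)))"
    by (simp add: a_def b_def algebra_simps)
  also have "cmod \<dots> \<le> (4 / s ^ 3 * r + r * (1 / s ^ 3)) + (1 * (2 / (s ^ 3 * \<epsilon>) * r) + (1 - s / 2) * ?D)"
    by (intro norm_triangle_mono t1 t2 t3 t4)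
  also have "\<dots> = (5 / s ^ 3 + 2 / (s ^ 3 * \<epsilon>)) * r + (1 - s / 2) * ?D"
  proof -
    have "(4 * p * r + r * p) + (1 * (q * r) + d) = (5 * p + q) * r + d" for p q d :: real
      by (simp add: algebra_simps)
    from this[of "1 / s ^ 3" "2 / (s ^ 3 * \<epsilon>)" "(1 - s / 2) * ?D"] show ?thesis
      by (simp only: times_divide_eq_right mult_1_right)
  qed
  \<comment> \<open>The claimed bound is the fixed point of
    \<open>X = A * r + (1 - s / 2) * X\<close>.\<close>
  also have "\<dots> = ?D"
  proof -
    have "A * r + (1 - s / 2) * (2 / s * A * r) = 2 / s * A * r" for A
      using s_pos by (simp add: field_simps)
    then show ?thesis .
  qed
  finally show ?case .
qed

end

section \<open>Creating a nonlinearity gap\<close>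

text \<open>
  The bump is a multiple of \<open>z ^ (n + 2) - z\<close> with \<open>n\<close> large; the linear term makes it vanish at
  the end points of the unit interval, so that adding it to a monotone map does not change the
  hull of the image. The point \<open>x0\<close> approaches \<open>1 + \<epsilon>\<close> like \<open>1 / n\<close>, which keeps the ratio of the
  size on the disc of radius \<open>1 + \<epsilon>\<close> to the size at \<open>x0\<close> bounded.
\<close>

lemma curvature_bump:
  fixes \<epsilon> \<sigma> t :: real
  assumes "0 < \<epsilon>" "0 < \<sigma>" "\<sigma> \<le> \<epsilon>" "0 < t"
  obtains \<phi> :: "complex \<Rightarrow> complex" and f :: "real \<Rightarrow> real" and x0 :: real where
    "\<phi> holomorphic_on UNIV" "\<And>x. \<phi> (complex_of_real x) = complex_of_real (f x)"
    "f 0 = 0" "f 1 = 0" "0 < x0" "x0 < 1 + \<epsilon>" "deriv (deriv \<phi>) (complex_of_real x0) = 1"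
    "\<And>z. cmod z \<le> 1 + \<epsilon> \<Longrightarrow> cmod (\<phi> z) \<le> t" "\<And>z. cmod z \<le> 1 + \<epsilon> \<Longrightarrow> cmod (deriv \<phi> z) \<le> t"
    "\<And>z. cmod z \<le> 1 + \<epsilon> - \<sigma> \<Longrightarrow> cmod (deriv (deriv \<phi>) z) \<le> t"
proof -
  define R where "R = 1 + \<epsilon>"
  define q where "q = (R - \<sigma>) / R"
  have R: "1 < R" "0 < R" "0 \<le> R - \<sigma>" using assms by (auto simp: R_def)
  have q: "0 \<le> q" "q < 1" using R assms by (auto simp: q_def)
  \<comment> \<open>This makes the second derivative small on the smaller disc; the next condition
    makes the bump and its first derivative small on the disc of radius \<open>R\<close>.\<close>
  have "\<forall>\<^sub>F n in sequentially. 2 * q ^ n < t"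
  proof (rule order_tendstoD)
    show "(\<lambda>n. 2 * q ^ n) \<longlonglongrightarrow> 0"
      using tendsto_mult_right_zero[OF LIMSEQ_power_zero[of q]] q by simp
  qed fact
  moreover have "\<forall>\<^sub>F n in sequentially. 4 * R\<^sup>2 / t \<le> real n"
    by (rule eventually_sequentiallyI[of "nat \<lceil>4 * R\<^sup>2 / t\<rceil>"]) linarith
  ultimately have "\<forall>\<^sub>F n in sequentially. 2 * q ^ n < t \<and> 4 * R\<^sup>2 / t \<le> real n"
    by (rule eventually_conj)
  then obtain n where n: "2 * q ^ n < t" "4 * R\<^sup>2 / t \<le> real n"
    by (auto simp: eventually_sequentially)
  define m where "m = real (n + 1)"
  have m: "1 \<le> m" "0 < m" by (auto simp: m_def)
  have "4 * R\<^sup>2 / t \<le> m" using n(2) by (simp add: m_def)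
  then have n': "4 * R\<^sup>2 / m \<le> t" using \<open>0 < t\<close> m by (simp add: field_simps)
  \<comment> \<open>At this distance from \<open>R\<close>, Bernoulli's inequality keeps
    \<open>x0 ^ n\<close> above half of \<open>R ^ n\<close>.\<close>
  define x0 where "x0 = R * (1 - 1 / (2 * m))"
  have x0: "0 < x0" "x0 < R"
    using m R by (auto simp: x0_def field_simps)
  have x0n: "R ^ n / 2 \<le> x0 ^ n"
  proof -
    have "1 + real n * (- 1 / (2 * m)) \<le> (1 + (- 1 / (2 * m))) ^ n"
      using m by (intro Bernoulli_inequality) (simp add: field_simps)
    moreover have "1 / 2 \<le> 1 + real n * (- 1 / (2 * m))"
      using m by (simp add: m_def field_simps)
    ultimately have "1 / 2 \<le> (1 - 1 / (2 * m)) ^ n" by simp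
    then have "R ^ n * (1 / 2) \<le> R ^ n * (1 - 1 / (2 * m)) ^ n"
      using R by (intro mult_left_mono) auto
    then show ?thesis by (simp add: x0_def power_mult_distrib)
  qed
  define c where "c = 1 / ((m + 1) * m * x0 ^ n)"
  have "0 < c" using m x0 by (simp add: c_def)
  \<comment> \<open>The normalisation at \<open>x0\<close> bounds the second derivative by 2 on the
    whole disc of radius \<open>R\<close>; the lower derivatives gain negative powers of
    \<open>m\<close>.\<close>
  have c_le: "c * R ^ n \<le> 2 / ((m + 1) * m)"
  proof -
    have "R ^ n / x0 ^ n \<le> 2" using x0n x0 by (simp add: divide_le_eq)
    then have "R ^ n / x0 ^ n / ((m + 1) * m) \<le> 2 / ((m + 1) * m)"
      using m by (intro divide_right_mono) auto
    then show ?thesis by (simp add: c_def field_simps)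
  qed
  define \<phi> where "\<phi> = (\<lambda>z. complex_of_real c * (z ^ (n + 2) - z))"
  define \<phi>' where "\<phi>' = (\<lambda>z. complex_of_real c * (complex_of_real (m + 1) * z ^ (n + 1) - 1))"
  define \<phi>'' where "\<phi>'' = (\<lambda>z. complex_of_real (c * (m + 1) * m) * z ^ n)"
  have d1: "deriv \<phi> = \<phi>'"
    unfolding \<phi>_def \<phi>'_def m_def
    by (rule ext, rule DERIV_imp_deriv) (auto intro!: derivative_eq_intros simp: algebra_simps; cases n; simp)
  have d2: "deriv \<phi>' = \<phi>''"
    unfolding \<phi>'_def \<phi>''_def m_def
    by (rule ext, rule DERIV_imp_deriv) (auto intro!: derivative_eq_intros simp: algebra_simps; cases n; simp add: algebra_simps)
  have R1: "1 \<le> R ^ (n + 1)" using R by (intro one_le_power) simp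
  show ?thesis
  proof (rule that[of \<phi> "\<lambda>x. c * (x ^ (n + 2) - x)" x0])
    show "\<phi> holomorphic_on UNIV" unfolding \<phi>_def by (intro holomorphic_intros)
    show "\<phi> (complex_of_real x) = complex_of_real (c * (x ^ (n + 2) - x))" for x
      by (simp add: \<phi>_def)
    show "0 < x0" "x0 < 1 + \<epsilon>" using x0 by (auto simp: R_def)
    have "c * (m + 1) * m * x0 ^ n = 1" using m x0 by (simp add: c_def)
    then show "deriv (deriv \<phi>) (complex_of_real x0) = 1"
      unfolding d1 d2 \<phi>''_def by (metis of_real_1 of_real_mult of_real_power)
    fix z :: complex
    show "cmod (deriv (deriv \<phi>) z) \<le> t" if "cmod z \<le> 1 + \<epsilon> - \<sigma>"
    proof -
      have "cmod (deriv (deriv \<phi>) z) = c * (m + 1) * m * cmod z ^ n"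
        unfolding d1 d2 \<phi>''_def using \<open>0 < c\<close> m by (simp add: norm_mult norm_power del: of_real_mult)
      also have "\<dots> \<le> c * (m + 1) * m * (R - \<sigma>) ^ n"
        using that \<open>0 < c\<close> m by (intro mult_left_mono power_mono) (auto simp: R_def)
      also have "\<dots> = c * R ^ n * ((m + 1) * m) * q ^ n"
        using R by (simp add: q_def power_divide)
      also have "\<dots> \<le> 2 / ((m + 1) * m) * ((m + 1) * m) * q ^ n"
        using c_le m q by (intro mult_right_mono) auto
      also have "\<dots> = 2 * q ^ n" using m by simp
      finally show ?thesis using n by simp
    qed
    assume "cmod z \<le> 1 + \<epsilon>"
    then have zR: "cmod z \<le> R" by (simp add: R_def)
    show "cmod (deriv \<phi> z) \<le> t"
    proof -
      have "cmod (deriv \<phi> z) = c * cmod (complex_of_real (m + 1) * z ^ (n + 1) - 1)"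
        unfolding d1 \<phi>'_def using \<open>0 < c\<close> by (simp add: norm_mult)
      also have "\<dots> \<le> c * (cmod (complex_of_real (m + 1) * z ^ (n + 1)) + cmod 1)"
        using \<open>0 < c\<close> by (intro mult_left_mono norm_triangle_ineq4) auto
      also have "cmod (complex_of_real (m + 1) * z ^ (n + 1)) = (m + 1) * cmod z ^ (n + 1)"
        using m by (simp add: norm_mult norm_power del: of_real_add)
      also have "c * ((m + 1) * cmod z ^ (n + 1) + cmod 1) \<le> c * ((m + 1) * R ^ (n + 1) + (m + 1) * R ^ (n + 1))"
      proof -
        have "1 * 1 \<le> (m + 1) * R ^ (n + 1)" using m R1 by (intro mult_mono) auto
        then show ?thesis
          using \<open>0 < c\<close> m zR by (intro mult_left_mono add_mono power_mono) auto
      qed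
      also have "\<dots> = 2 * (m + 1) * R * (c * R ^ n)" by (simp add: algebra_simps)
      also have "\<dots> \<le> 2 * (m + 1) * R * (2 / ((m + 1) * m))"
        using c_le m R by (intro mult_left_mono) auto
      also have "\<dots> = 4 * R / m"
      proof -
        have "2 * u * R * (2 / (u * m)) = 4 * R / m" if "0 < u" for u
          using that m by (simp add: field_simps)
        from this[of "m + 1"] show ?thesis using m by simp
      qed
      also have "\<dots> \<le> 4 * R\<^sup>2 / m"
        using R m by (intro divide_right_mono) (auto simp: power2_eq_square)
      finally show ?thesis using n' by simp
    qed
    show "cmod (\<phi> z) \<le> t"
    proof -
      have "cmod (\<phi> z) = c * cmod (z ^ (n + 2) - z)"
        unfolding \<phi>_def using \<open>0 < c\<close> by (simp add: norm_mult)
      also have "\<dots> \<le> c * (cmod (z ^ (n + 2)) + cmod z)"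
        using \<open>0 < c\<close> by (intro mult_left_mono norm_triangle_ineq4) auto
      also have "\<dots> \<le> c * (R ^ (n + 2) + R ^ (n + 2))"
      proof -
        have "R * 1 \<le> R * R ^ (n + 1)" using R R1 by (intro mult_left_mono) auto
        then have "cmod z \<le> R ^ (n + 2)" using zR by simp
        then show ?thesis
          unfolding norm_power using \<open>0 < c\<close> zR by (intro mult_left_mono add_mono power_mono) auto
      qed
      also have "\<dots> = 2 * R\<^sup>2 * (c * R ^ n)" by (simp add: algebra_simps power_add power2_eq_square)
      also have "\<dots> \<le> 2 * R\<^sup>2 * (2 / ((m + 1) * m))"
        using c_le by (intro mult_left_mono) auto
      also have "\<dots> \<le> 2 * R\<^sup>2 * (2 / (1 * m))"
        using m by (intro mult_left_mono divide_left_mono mult_right_mono) auto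
      finally show ?thesis using n' by simp
    qed
  qed auto
qed

section \<open>From a gap at one point to a gap on the interval\<close>

context analytic_ifs
begin

text \<open>A quantitative identity theorem: differences of word nonlinearities form a uniformly
  bounded analytic family, so being at least 1 at \<open>z0\<close> forces a uniform lower bound on
  the interval.\<close>

lemma nonlin_gap_if_point_gap:
  assumes z0: "z0 \<in> B_nbhd \<epsilon>"
    and gap: "\<And>k l v w. k \<in> {1..N} \<Longrightarrow> l \<in> {1..N} \<Longrightarrow> k \<noteq> l \<Longrightarrow> set v \<subseteq> {1..N} \<Longrightarrow> set w \<subseteq> {1..N} \<Longrightarrow>
      1 \<le> cmod (word_nonlin F (k # v) z0 - word_nonlin F (l # w) z0)"
  shows "\<exists>\<delta>. nonlin_gap N F \<delta>"
proof -
  have "{z0} \<subseteq> B_nbhd \<epsilon>" using z0 by simp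
  from uniform_lower_bound_on_subintervals[OF eps_pos zero_less_one _ this, of "2 / s ^ 3"]
  obtain c E where c: "0 < c" and cE: "\<And>g a b. g holomorphic_on B_nbhd \<epsilon> \<Longrightarrow>
      \<forall>z\<in>B_nbhd \<epsilon>. cmod (g z) \<le> 2 / s ^ 3 \<Longrightarrow> \<exists>z\<in>{z0}. 1 \<le> cmod (g z) \<Longrightarrow>
      0 \<le> a \<Longrightarrow> a < b \<Longrightarrow> b \<le> 1 \<Longrightarrow> \<exists>x\<in>{a..b}. (c * (b - a)) ^ E \<le> cmod (g (complex_of_real x))"
    by (simp del: atLeastAtMost_iff) blast
  have "\<exists>x\<in>{0..1}. c ^ E \<le>
      cmod (word_nonlin F (k # v) (complex_of_real x) - word_nonlin F (l # w) (complex_of_real x))"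
    if kl: "k \<in> {1..N}" "l \<in> {1..N}" "k \<noteq> l" and vw: "set v \<subseteq> {1..N}" "set w \<subseteq> {1..N}" for k l v w
  proof -
    have kv: "set (k # v) \<subseteq> {1..N}" and lw: "set (l # w) \<subseteq> {1..N}" using kl vw by auto
    have "\<exists>x\<in>{0..1}. (c * (1 - 0)) ^ E \<le>
        cmod ((\<lambda>z. word_nonlin F (k # v) z - word_nonlin F (l # w) z) (complex_of_real x))"
    proof (rule cE[OF word_nonlin_diff_hol[OF kv lw]])
      show "\<forall>z\<in>B_nbhd \<epsilon>. cmod (word_nonlin F (k # v) z - word_nonlin F (l # w) z) \<le> 2 / s ^ 3"
        using word_nonlin_diff_le[OF kv lw] by blast
      show "\<exists>z\<in>{z0}. 1 \<le> cmod (word_nonlin F (k # v) z - word_nonlin F (l # w) z)"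
        using gap[OF kl vw] by blast
    qed auto
    then show ?thesis by (simp only: diff_zero mult_1_right)
  qed
  then have "nonlin_gap N F (c ^ E)"
    unfolding nonlin_gap_def using zero_less_power[OF c] by blast
  then show ?thesis ..
qed

end

lemma B_nbhd_perturb:
  assumes "z \<in> B_nbhd \<rho>" "cmod (w - z) \<le> e"
  shows "w \<in> B_nbhd (\<rho> + e)"
proof -
  obtain x where x: "x \<in> {0..1}" "cmod (z - complex_of_real x) < \<rho>"
    using assms by (auto simp: B_nbhd_def)
  have "cmod (w - complex_of_real x) < \<rho> + e"
    using norm_triangle_ineq[of "w - z" "z - complex_of_real x"] x assms by simp
  then show ?thesis using x by (auto simp: B_nbhd_def)
qed

text \<open>The inclusion of the image in the interval may hold without slack, so smallness of
  \<open>g\<close> alone would not preserve it. As \<open>e < s\<close>, the sum is injective and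
  continuous, hence monotone, and its values lie between the unchanged end values.\<close>

lemma perturb_preserves_unit:
  fixes f g :: "real \<Rightarrow> real"
  assumes f: "\<And>x y. x \<in> {0..1} \<Longrightarrow> y \<in> {0..1} \<Longrightarrow> s * \<bar>x - y\<bar> \<le> \<bar>f x - f y\<bar>"
    and g: "\<And>x y. x \<in> {0..1} \<Longrightarrow> y \<in> {0..1} \<Longrightarrow> \<bar>g x - g y\<bar> \<le> e * \<bar>x - y\<bar>" and "e < s"
    and cont: "continuous_on {0..1} f"
    and ends: "g 0 = 0" "g 1 = 0" "f 0 \<in> {0..1}" "f 1 \<in> {0..1}" and x: "x \<in> {0..1}"
  shows "f x + g x \<in> {0..1}"
proof (cases "x \<in> {0, 1}")
  case True
  then show ?thesis using ends by auto
next
  case False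
  have "inj_on (\<lambda>x. f x + g x) {0..1}"
  proof (rule inj_onI)
    fix u v assume uv: "u \<in> {0..1}" "v \<in> {0..1}" "f u + g u = f v + g v"
    then have "f u - f v = - (g u - g v)" by simp
    then have "\<bar>f u - f v\<bar> = \<bar>g u - g v\<bar>" by (metis abs_minus_cancel)
    then have "s * \<bar>u - v\<bar> \<le> e * \<bar>u - v\<bar>" using f[OF uv(1,2)] g[OF uv(1,2)] by simp
    then show "u = v" using \<open>e < s\<close> by (simp add: mult_le_cancel_right)
  qed
  moreover have "continuous_on {0..1} g"
  proof (rule lipschitz_on_continuous_on)
    show "\<bar>e\<bar>-lipschitz_on {0..1} g"
    proof (rule lipschitz_onI)
      show "dist (g u) (g v) \<le> \<bar>e\<bar> * dist u v" if "u \<in> {0..1}" "v \<in> {0..1}" for u v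
        using order_trans[OF g[OF that] mult_right_mono[OF abs_ge_self abs_ge_zero]]
        by (simp add: dist_real_def)
    qed simp
  qed
  ultimately show ?thesis
    using continuous_inj_imp_mono[of 0 x 1 "\<lambda>x. f x + g x"] cont False x ends
    by (force intro: continuous_on_add)
qed

section \<open>Construction of the perturbed system\<close>

context analytic_ifs
begin

lemma Phi_continuous: "k \<in> {1..N} \<Longrightarrow> continuous_on {0..1} (\<Phi> k)"
  using comp_word_continuous[of "[k]"] by (simp add: comp_word_def)

theorem nonlin_gap_dense:
  assumes "0 < N" and ext: "\<And>k. k \<in> {1..N} \<Longrightarrow> analytic_ext \<epsilon> (\<Phi> k) (F k)" and "0 < r"
  shows "\<exists>\<Psi> G \<delta>. (\<forall>k\<in>{1..N}. analytic_ext \<epsilon> (\<Psi> k) (G k) \<and> d2 (\<Phi> k) (\<Psi> k) < r) \<and> nonlin_gap N G \<delta>"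
proof -
  have "s < \<epsilon>"
  proof -
    have "F 1 0 \<in> B_nbhd (\<epsilon> - s)"
      using \<open>0 < N\<close> of_real_in_B_nbhd[of 0 \<epsilon>] eps_pos by (intro maps_margin closure_B_nbhd_mem) auto
    then obtain x where "cmod (F 1 0 - complex_of_real x) < \<epsilon> - s" by (auto simp: B_nbhd_def)
    then show ?thesis using norm_ge_zero[of "F 1 0 - complex_of_real x"] by linarith
  qed
  \<comment> \<open>For two words, each first letter deviates from its intended shift by at most
    \<open>1 / s\<^sup>2 + 1\<close> and each tail contributes at most \<open>8 / s ^ 3\<close>; the
    final 1 is the gap that remains.\<close>
  define H where "H = 2 * (1 / s\<^sup>2 + 1) + 2 * (8 / s ^ 3) + 1"
  have "1 \<le> H" using s_pos by (simp add: H_def)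
  define T where "T = real N * H"
  have "0 < T" using \<open>0 < N\<close> \<open>1 \<le> H\<close> by (simp add: T_def)
  \<comment> \<open>In this order: half of every margin survives, the denominator
    \<open>1 + y * p\<close> stays above \<open>1 / 2\<close>, the error in the shift of the
    nonlinearity is at most 1, and \<open>3 * e < r\<close>.\<close>
  define e where "e = min (min (s / 2) (1 / 2)) (min (1 / (2 * (1 / s\<^sup>2 + T))) (r / 4))"
  have "0 < 1 / s\<^sup>2 + T" using s_pos \<open>0 < T\<close> by (simp add: add_pos_pos)
  then have e: "0 < e" "e \<le> s / 2" "e \<le> 1 / 2" "e \<le> 1 / (2 * (1 / s\<^sup>2 + T))" "e \<le> r / 4"
    using s_pos \<open>0 < r\<close> by (auto simp: e_def)
  have e': "(1 / s\<^sup>2 + T) * (2 * e) \<le> 1"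
    using e(4) \<open>0 < 1 / s\<^sup>2 + T\<close> by (simp add: le_divide_eq mult_ac)
  obtain \<phi> f x0 where \<phi>: "\<phi> holomorphic_on UNIV" and \<phi>f: "\<And>x. \<phi> (complex_of_real x) = complex_of_real (f x)"
    and f01: "f 0 = 0" "f 1 = 0" and x0: "0 < x0" "x0 < 1 + \<epsilon>"
    and \<phi>2x0: "deriv (deriv \<phi>) (complex_of_real x0) = 1"
    and \<phi>_le: "\<And>z. cmod z \<le> 1 + \<epsilon> \<Longrightarrow> cmod (\<phi> z) \<le> e / T" "\<And>z. cmod z \<le> 1 + \<epsilon> \<Longrightarrow> cmod (deriv \<phi> z) \<le> e / T"
    "\<And>z. cmod z \<le> 1 + \<epsilon> - s / 2 \<Longrightarrow> cmod (deriv (deriv \<phi>) z) \<le> e / T"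
    using curvature_bump[of \<epsilon> "s / 2" "e / T"] eps_pos s_pos \<open>s < \<epsilon>\<close> e \<open>0 < T\<close> by auto
  let ?K = "closure (B_nbhd \<epsilon>)" and ?z0 = "complex_of_real x0"
  have z0: "?z0 \<in> B_nbhd \<epsilon>"
  proof (cases "x0 \<le> 1")
    case True
    then show ?thesis using x0 eps_pos by (intro of_real_in_B_nbhd) auto
  next
    case False
    then have "cmod (?z0 - complex_of_real 1) < \<epsilon>"
      unfolding of_real_diff[symmetric] norm_of_real using x0 by simp
    then show ?thesis unfolding B_nbhd_def by (intro CollectI bexI[of _ 1]) auto
  qed
  have z0K: "?z0 \<in> ?K" using z0 by (rule closure_B_nbhd_mem)
  define d where "d = (\<lambda>k. deriv (\<Phi> k) x0)"
  have Fd: "deriv (F k) ?z0 = complex_of_real (d k)" if "k \<in> {1..N}" for k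
    unfolding d_def using z0 B_subset by (intro analytic_ext_deriv(1)[OF ext[OF that]]) auto
  have d: "s \<le> \<bar>d k\<bar>" "\<bar>d k\<bar> \<le> 1" if "k \<in> {1..N}" for k
    using deriv_ge[OF that z0K] deriv_le[OF that z0K] s_pos unfolding Fd[OF that] norm_of_real by auto
  \<comment> \<open>The factor \<open>d k\<close> is the derivative of \<open>F k\<close> at
    \<open>x0\<close>; it cancels the denominator of the nonlinearity, so that the shift is close to
    \<open>real k * H\<close>.\<close>
  define \<tau> where "\<tau> = (\<lambda>k. real k * H * d k)"
  have \<tau>: "\<bar>\<tau> k\<bar> \<le> T" if "k \<in> {1..N}" for k
  proof -
    have "real k * H * \<bar>d k\<bar> \<le> real N * H * 1"
      using that d[OF that] \<open>1 \<le> H\<close> by (intro mult_mono) auto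
    then show ?thesis using \<open>1 \<le> H\<close> by (simp add: \<tau>_def T_def abs_mult)
  qed
  define G where "G = (\<lambda>k z. F k z + complex_of_real (\<tau> k) * \<phi> z)"
  define \<Psi> where "\<Psi> = (\<lambda>k x. \<Phi> k x + \<tau> k * f x)"
  have small: "cmod (complex_of_real (\<tau> k) * y) \<le> e" if "k \<in> {1..N}" "cmod y \<le> e / T" for k y
  proof -
    have "cmod (complex_of_real (\<tau> k) * y) \<le> T * (e / T)"
      unfolding norm_mult norm_of_real using \<tau>[OF that(1)] that(2) \<open>0 < T\<close> by (intro mult_mono) auto
    then show ?thesis using \<open>0 < T\<close> by simp
  qed
  have \<phi>_deriv: "(\<phi> has_field_derivative deriv \<phi> z) (at z)"
    "(deriv \<phi> has_field_derivative deriv (deriv \<phi>) z) (at z)" for z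
    using holomorphic_derivI[OF \<phi> open_UNIV] holomorphic_derivI[OF holomorphic_deriv[OF \<phi> open_UNIV] open_UNIV]
    by auto
  have G1: "deriv (G k) z = deriv (F k) z + complex_of_real (\<tau> k) * deriv \<phi> z"
    if "k \<in> {1..N}" "z \<in> B_nbhd (2 * \<epsilon>)" for k z
    unfolding G_def
    by (intro DERIV_imp_deriv DERIV_add DERIV_cmult \<phi>_deriv has_deriv_B_nbhd[OF hol] that)
  have G2: "deriv (deriv (G k)) z = deriv (deriv (F k)) z + complex_of_real (\<tau> k) * deriv (deriv \<phi>) z"
    if "k \<in> {1..N}" "z \<in> B_nbhd (2 * \<epsilon>)" for k z
  proof -
    have "deriv (deriv (G k)) z = deriv (\<lambda>z. deriv (F k) z + complex_of_real (\<tau> k) * deriv \<phi> z) z"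
      using eventually_nhds_in_open[OF open_B_nbhd that(2)]
      by (intro deriv_cong_ev) (auto elim!: eventually_mono intro: G1 that(1))
    also have "\<dots> = deriv (deriv (F k)) z + complex_of_real (\<tau> k) * deriv (deriv \<phi>) z"
      by (intro DERIV_imp_deriv DERIV_add DERIV_cmult \<phi>_deriv
          has_deriv_B_nbhd[OF holomorphic_deriv[OF hol open_B_nbhd]] that)
    finally show ?thesis .
  qed
  have K2: "?K \<subseteq> B_nbhd (2 * \<epsilon>)" using eps_pos by (intro closure_B_nbhd_subset_B_nbhd) auto
  have G_near: "cmod (G k z - F k z) \<le> e" "cmod (deriv (G k) z - deriv (F k) z) \<le> e"
    if "k \<in> {1..N}" "z \<in> ?K" for k z
  proof -
    have z: "cmod z \<le> 1 + \<epsilon>" "z \<in> B_nbhd (2 * \<epsilon>)"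
      using that K2 norm_le_if_in_closure_B_nbhd by auto
    show "cmod (G k z - F k z) \<le> e" using small[OF that(1) \<phi>_le(1)[OF z(1)]] by (simp add: G_def)
    show "cmod (deriv (G k) z - deriv (F k) z) \<le> e"
      using small[OF that(1) \<phi>_le(2)[OF z(1)]] by (simp add: G1[OF that(1) z(2)])
  qed
  \<comment> \<open>Here the bump is small up to its second derivative. The set contains the unit
    segment and all images of the closure under the new maps, but not \<open>?z0\<close>.\<close>
  let ?B = "B_nbhd (\<epsilon> - s / 2)"
  have BK: "?B \<subseteq> ?K" using B_nbhd_mono[of "\<epsilon> - s / 2" \<epsilon>] s_pos closure_subset[of "B_nbhd \<epsilon>"] by auto
  have G_near2: "cmod (deriv (deriv (G k)) z - deriv (deriv (F k)) z) \<le> e"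
    if "k \<in> {1..N}" "z \<in> ?B" for k z
  proof -
    have z: "cmod z \<le> 1 + \<epsilon> - s / 2" "z \<in> B_nbhd (2 * \<epsilon>)"
      using that BK K2 norm_less_if_in_B_nbhd[of z "\<epsilon> - s / 2"] by auto
    show ?thesis
      using small[OF that(1) \<phi>_le(3)[OF z(1)]] by (simp add: G2[OF that(1) z(2)])
  qed
  have G_maps: "G k z \<in> ?B" if "k \<in> {1..N}" "z \<in> ?K" for k z
    using B_nbhd_perturb[OF maps_margin[OF that] G_near(1)[OF that]] e(2)
      B_nbhd_mono[of "\<epsilon> - s + e" "\<epsilon> - s / 2"] by auto
  have G_deriv: "s / 2 \<le> cmod (deriv (G k) z)" "cmod (deriv (G k) z) \<le> 1 - s / 2"
    if "k \<in> {1..N}" "z \<in> ?K" for k z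
    using deriv_ge[OF that] deriv_le[OF that] G_near(2)[OF that] e(2)
      norm_triangle_ineq2[of "deriv (F k) z" "deriv (G k) z"]
      norm_triangle_ineq2[of "deriv (G k) z" "deriv (F k) z"]
      norm_minus_commute[of "deriv (F k) z" "deriv (G k) z"] by linarith+
  have \<Psi>I: "\<Psi> k x \<in> {0..1}" if "k \<in> {1..N}" "x \<in> {0..1}" for k x
    unfolding \<Psi>_def
  proof (rule perturb_preserves_unit[where s = s and e = e and f = "\<Phi> k" and g = "\<lambda>x. \<tau> k * f x"])
    show "s * \<bar>u - v\<bar> \<le> \<bar>\<Phi> k u - \<Phi> k v\<bar>" if "u \<in> {0..1}" "v \<in> {0..1}" for u v
      using that \<open>k \<in> {1..N}\<close> by (intro map_expansion_lower)
    show "\<bar>\<tau> k * f u - \<tau> k * f v\<bar> \<le> e * \<bar>u - v\<bar>" if "u \<in> {0..1}" "v \<in> {0..1}" for u v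
    proof -
      have "cmod (complex_of_real (\<tau> k) * \<phi> (complex_of_real u) - complex_of_real (\<tau> k) * \<phi> (complex_of_real v))
        \<le> e * cmod (complex_of_real u - complex_of_real v)"
      proof (rule field_differentiable_bound[where S = unit_seg])
        show "convex unit_seg" by (intro convex_of_real_image) auto
        show "((\<lambda>z. complex_of_real (\<tau> k) * \<phi> z) has_field_derivative complex_of_real (\<tau> k) * deriv \<phi> z)
            (at z within unit_seg)" for z
          by (intro DERIV_cmult has_field_derivative_at_within[OF \<phi>_deriv(1)])
        show "cmod (complex_of_real (\<tau> k) * deriv \<phi> z) \<le> e" if "z \<in> unit_seg" for z
          using that eps_pos by (intro small \<open>k \<in> {1..N}\<close> \<phi>_le) auto
      qed (use that in auto)
      then show ?thesis unfolding \<phi>f by (simp flip: of_real_diff of_real_mult)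
    qed
    show "e < s" using e s_pos by linarith
    show "\<Phi> k 0 \<in> {0..1}" "\<Phi> k 1 \<in> {0..1}" using that by (intro unit_maps; simp)+
  qed (use that f01 Phi_continuous in auto)
  have extG: "analytic_ext \<epsilon> (\<Psi> k) (G k)" if k: "k \<in> {1..N}" for k
    unfolding analytic_ext_def
  proof (intro conjI ballI allI impI)
    show "G k analytic_on B_nbhd (2 * \<epsilon>)"
      unfolding analytic_on_open[OF open_B_nbhd] G_def
      using \<phi> by (intro holomorphic_intros hol k holomorphic_on_subset[OF \<phi>]) auto
    show "G k (complex_of_real x) = complex_of_real (\<Psi> k x)" if "complex_of_real x \<in> B_nbhd (2 * \<epsilon>)" for x
    proof -
      have "F k (complex_of_real x) = complex_of_real (\<Phi> k x)"
        using ext[OF k] that unfolding analytic_ext_def by blast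
      then show ?thesis by (simp add: G_def \<Psi>_def \<phi>f)
    qed
    show "\<Psi> k ` {0..1} \<subseteq> {0..1}" using \<Psi>I[OF k] by blast
    show "G k ` ?K \<subseteq> B_nbhd \<epsilon>"
      using G_maps[OF k] B_nbhd_mono[of "\<epsilon> - s / 2" \<epsilon>] s_pos by auto
    show "0 < cmod (deriv (G k) z)" "cmod (deriv (G k) z) < 1" if "z \<in> ?K" for z
      using G_deriv[OF k that] s_pos by linarith+
  qed
  have unitB: "complex_of_real x \<in> ?B" if "x \<in> {0..1}" for x
    using that \<open>s < \<epsilon>\<close> s_pos by (intro of_real_in_B_nbhd) auto
  have d2_less: "d2 (\<Phi> k) (\<Psi> k) < r" if k: "k \<in> {1..N}" for k
  proof -
    have "d2 (\<Phi> k) (\<Psi> k) \<le> 3 * e"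
    proof (rule d2_le[OF eps_pos ext[OF k] extG[OF k]])
      fix x :: real assume "x \<in> {0..1}"
      then have x: "complex_of_real x \<in> ?B" "complex_of_real x \<in> ?K" using unitB BK by auto
      show "cmod (F k (complex_of_real x) - G k (complex_of_real x)) \<le> e"
        "cmod (deriv (F k) (complex_of_real x) - deriv (G k) (complex_of_real x)) \<le> e"
        "cmod (deriv (deriv (F k)) (complex_of_real x) - deriv (deriv (G k)) (complex_of_real x)) \<le> e"
        using G_near[OF k x(2)] G_near2[OF k x(1)] by (simp_all add: norm_minus_commute)
    qed
    then show ?thesis using e \<open>0 < r\<close> by linarith
  qed
  have nonlin_G_le: "cmod (nonlin (G k) z) \<le> 4 / s\<^sup>2" if k: "k \<in> {1..N}" and z: "z \<in> ?B" for k z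
  proof -
    have zK: "z \<in> ?K" using z BK by blast
    have "1 \<le> 1 / s" using s_pos s_less_1 by (simp add: le_divide_eq)
    then have "e \<le> 1 / s" using e(3) by linarith
    then have "cmod (deriv (deriv (G k)) z) \<le> 2 / s"
      using deriv2_le[OF k zK] G_near2[OF k z]
        norm_triangle_sub[of "deriv (deriv (G k)) z" "deriv (deriv (F k)) z"] by simp
    then have "cmod (nonlin (G k) z) \<le> (2 / s) / (s / 2)"
      unfolding nonlin_def norm_divide using G_deriv(1)[OF k zK] s_pos by (intro frac_le) auto
    then show ?thesis by (simp add: power2_eq_square)
  qed
  \<comment> \<open>The fixed point of \<open>X = 4 / s\<^sup>2 + (1 - s / 2) * X\<close>. The
    induction stays in \<open>?B\<close>, which the new maps preserve, so it bounds the tails after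
    one step from \<open>?z0\<close>.\<close>
  have word_G_le: "cmod (word_nonlin G w z) \<le> 8 / s ^ 3" if "set w \<subseteq> {1..N}" "z \<in> ?B" for w z
    using that
  proof (induction w arbitrary: z)
    case Nil
    then show ?case using s_pos by simp
  next
    case (Cons k w)
    have k: "k \<in> {1..N}" and w: "set w \<subseteq> {1..N}" using Cons.prems by auto
    have zK: "z \<in> ?K" using Cons.prems BK by blast
    have "cmod (word_nonlin G (k # w) z)
        \<le> cmod (nonlin (G k) z) + cmod (deriv (G k) z) * cmod (word_nonlin G w (G k z))"
      by (simp add: norm_mult[symmetric] norm_triangle_ineq)
    also have "\<dots> \<le> 4 / s\<^sup>2 + (1 - s / 2) * (8 / s ^ 3)"
      using nonlin_G_le[OF k Cons.prems(2)] G_deriv[OF k zK] Cons.IH[OF w G_maps[OF k zK]] s_less_1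
      by (intro add_mono mult_mono) auto
    also have "\<dots> = 8 / s ^ 3"
      using s_pos by (simp add: field_simps power2_eq_square power3_eq_cube)
    finally show ?case .
  qed
  have nonlin_z0: "cmod (nonlin (G k) ?z0 - complex_of_real (real k * H)) \<le> 1 / s\<^sup>2 + 1"
    if k: "k \<in> {1..N}" for k
  proof -
    define a where "a = nonlin (F k) ?z0"
    define y where "y = complex_of_real (real k * H)"
    define p where "p = deriv \<phi> ?z0"
    have "d k \<noteq> 0" using d[OF k] s_pos by auto
    have zz: "?z0 \<in> B_nbhd (2 * \<epsilon>)" using z0 B_subset by blast
    have a: "deriv (deriv (F k)) ?z0 = a * complex_of_real (d k)"
      using \<open>d k \<noteq> 0\<close> unfolding a_def nonlin_def Fd[OF k] by simp
    have ty: "complex_of_real (\<tau> k) = y * complex_of_real (d k)" by (simp add: \<tau>_def y_def)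
    have y_le: "cmod y \<le> T"
      unfolding y_def norm_of_real T_def using k \<open>1 \<le> H\<close> by (simp add: abs_mult)
    have p_le: "cmod p \<le> e / T" unfolding p_def using x0 by (intro \<phi>_le(2)) simp
    have yp: "cmod (y * p) \<le> e"
    proof -
      have "cmod y * cmod p \<le> T * (e / T)" using y_le p_le \<open>0 < T\<close> by (intro mult_mono) auto
      then show ?thesis using \<open>0 < T\<close> by (simp add: norm_mult)
    qed
    have half: "1 / 2 \<le> cmod (1 + y * p)"
      using norm_diff_ineq[of 1 "y * p"] yp e(3) by simp
    then have nz: "1 + y * p \<noteq> 0" by auto
    have "nonlin (G k) ?z0 = (a + y) * complex_of_real (d k) / ((1 + y * p) * complex_of_real (d k))"
      unfolding nonlin_def G1[OF k zz] G2[OF k zz] \<phi>2x0 Fd[OF k] a ty p_def[symmetric]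
      by (simp add: algebra_simps)
    also have "\<dots> = (a + y) / (1 + y * p)" using \<open>d k \<noteq> 0\<close> by simp
    \<comment> \<open>The last term is the effect of the first derivative \<open>p\<close> of the
      bump; \<open>e'\<close> bounds it by 1.\<close>
    finally have "nonlin (G k) ?z0 - y = a - (a + y) * (y * p) / (1 + y * p)"
      using nz by (simp add: field_simps)
    then have "cmod (nonlin (G k) ?z0 - y) \<le> cmod a + cmod (a + y) * cmod (y * p) / cmod (1 + y * p)"
      using norm_triangle_ineq4[of a "(a + y) * (y * p) / (1 + y * p)"]
      by (simp only: norm_divide norm_mult)
    also have "\<dots> \<le> 1 / s\<^sup>2 + (1 / s\<^sup>2 + T) * e / (1 / 2)"
    proof -
      have "cmod a \<le> 1 / s\<^sup>2" unfolding a_def by (rule nonlin_le[OF k z0K])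
      moreover from this have "cmod (a + y) \<le> 1 / s\<^sup>2 + T"
        using y_le by (intro norm_triangle_mono)
      ultimately show ?thesis
        using yp half e(1) \<open>0 < 1 / s\<^sup>2 + T\<close> by (intro add_mono frac_le mult_mono mult_nonneg_nonneg) auto
    qed
    also have "\<dots> \<le> 1 / s\<^sup>2 + 1" using e' by (simp add: mult_ac)
    finally show ?thesis by (simp only: y_def)
  qed
  have point_gap: "1 \<le> cmod (word_nonlin G (k # v) ?z0 - word_nonlin G (l # w) ?z0)"
    if k: "k \<in> {1..N}" and l: "l \<in> {1..N}" and "k \<noteq> l" and v: "set v \<subseteq> {1..N}" and w: "set w \<subseteq> {1..N}"
    for k l v w
  proof -
    have tail: "cmod (deriv (G k) ?z0 * word_nonlin G v (G k ?z0)) \<le> 8 / s ^ 3"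
      if "k \<in> {1..N}" "set v \<subseteq> {1..N}" for k v
    proof -
      have "cmod (deriv (G k) ?z0 * word_nonlin G v (G k ?z0)) \<le> 1 * (8 / s ^ 3)"
        unfolding norm_mult
        using G_deriv[OF that(1) z0K] s_pos word_G_le[OF that(2) G_maps[OF that(1) z0K]]
        by (intro mult_mono) auto
      then show ?thesis by simp
    qed
    have "1 \<le> \<bar>real k - real l\<bar>" using \<open>k \<noteq> l\<close> by linarith
    then have "1 * H \<le> \<bar>real k - real l\<bar> * H" using \<open>1 \<le> H\<close> by (intro mult_right_mono) auto
    also have "\<dots> = cmod (complex_of_real (real k * H) - complex_of_real (real l * H))"
      unfolding of_real_diff[symmetric] norm_of_real
      using \<open>1 \<le> H\<close> by (simp add: left_diff_distrib[symmetric] abs_mult)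
    finally have H_le: "H \<le> cmod (complex_of_real (real k * H) - complex_of_real (real l * H))" by simp
    have tri: "cmod (y1 - y2) \<le> cmod ((a1 + b1) - (a2 + b2)) + cmod (a1 - y1) + cmod (a2 - y2) + cmod b1 + cmod b2"
      for y1 y2 a1 a2 b1 b2 :: complex by norm
    have arith: "1 \<le> X" if "Y \<le> X + A + B + C + D" "H \<le> Y" "A \<le> p + 1" "B \<le> p + 1" "C \<le> q" "D \<le> q"
      "H = 2 * (p + 1) + 2 * q + 1" for X Y A B C D p q
      using that by (simp add: algebra_simps)
    show ?thesis
      unfolding word_nonlin.simps(2)
      by (rule arith[OF tri H_le nonlin_z0[OF k] nonlin_z0[OF l] tail[OF k v] tail[OF l w] H_def])
  qed
  obtain s' where "analytic_ifs \<epsilon> s' N \<Psi> G"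
    using analytic_ifs_exists[where N = N and \<Phi> = \<Psi> and F = G, OF eps_pos extG] by blast
  then obtain \<delta> where "nonlin_gap N G \<delta>"
    using analytic_ifs.nonlin_gap_if_point_gap[OF _ z0 point_gap] by blast
  with extG d2_less show ?thesis by blast
qed

end

section \<open>Openness and density\<close>

context analytic_ifs
begin

theorem nonlin_gap_stable:
  assumes ext: "\<And>k. k \<in> {1..N} \<Longrightarrow> analytic_ext \<epsilon> (\<Phi> k) (F k)" and gap: "nonlin_gap N F \<delta>"
  shows "\<exists>r>0. \<forall>\<Psi> G. (\<forall>k\<in>{1..N}. analytic_ext \<epsilon> (\<Psi> k) (G k) \<and> d2 (\<Phi> k) (\<Psi> k) < r) \<longrightarrow>
    nonlin_gap N G (\<delta> / 2)"
proof -
  define A where "A = 2 / s * (5 / s ^ 3 + 2 / (s ^ 3 * \<epsilon>))"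
  \<comment> \<open>Each of the two words then loses at most \<open>\<delta> / 4\<close>, so half of
    the gap survives.\<close>
  define r where "r = min (s / 2) (\<delta> / (4 * A))"
  have "0 < \<delta>" using gap by (simp add: nonlin_gap_def)
  have "0 < A" unfolding A_def using s_pos eps_pos by (intro mult_pos_pos add_pos_pos) auto
  then have r: "0 < r" "r \<le> s / 2" "r \<le> \<delta> / (4 * A)"
    using s_pos \<open>0 < \<delta>\<close> by (auto simp: r_def)
  then have Ar: "A * r \<le> \<delta> / 4" using \<open>0 < A\<close> by (simp add: field_simps)
  have "nonlin_gap N G (\<delta> / 2)"
    if near: "\<forall>k\<in>{1..N}. analytic_ext \<epsilon> (\<Psi> k) (G k) \<and> d2 (\<Phi> k) (\<Psi> k) < r" for \<Psi> G
  proof -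
    have close: "cmod (word_nonlin F w (complex_of_real x) - word_nonlin G w (complex_of_real x)) \<le> \<delta> / 4"
      if "set w \<subseteq> {1..N}" "x \<in> {0..1}" for w x
    proof -
      have "cmod (word_nonlin F w (complex_of_real x) - word_nonlin G w (complex_of_real x)) \<le> A * r"
        unfolding A_def
      proof (rule word_nonlin_perturb[OF less_imp_le[OF r(1)] r(2) _ _ _ _ _ that])
        fix k x assume k: "k \<in> {1..N}" and x: "x \<in> {0..1::real}"
        have extG: "analytic_ext \<epsilon> (\<Psi> k) (G k)" and d: "d2 (\<Phi> k) (\<Psi> k) < r" using near k by auto
        show "G k (complex_of_real x) = complex_of_real (\<Psi> k x)"
          using extG of_real_in_B_nbhd[OF x, of "2 * \<epsilon>"] eps_pos unfolding analytic_ext_def by simp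
        show "\<Psi> k x \<in> {0..1}" using extG x unfolding analytic_ext_def by blast
        note D = d2_lessD[OF eps_pos ext[OF k] extG d x]
        show "cmod (F k (complex_of_real x) - G k (complex_of_real x)) \<le> r"
          "cmod (deriv (F k) (complex_of_real x) - deriv (G k) (complex_of_real x)) \<le> r"
          "cmod (deriv (deriv (F k)) (complex_of_real x) - deriv (deriv (G k)) (complex_of_real x)) \<le> r"
          using D by linarith+
      qed
      then show ?thesis using Ar by simp
    qed
    have "\<exists>x\<in>{0..1}. \<delta> / 2 \<le>
        cmod (word_nonlin G (k # v) (complex_of_real x) - word_nonlin G (l # w) (complex_of_real x))"
      if kl: "k \<in> {1..N}" "l \<in> {1..N}" "k \<noteq> l" and vw: "set v \<subseteq> {1..N}" "set w \<subseteq> {1..N}" for k l v w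
    proof -
      obtain x where x: "x \<in> {0..1}" "\<delta> \<le>
          cmod (word_nonlin F (k # v) (complex_of_real x) - word_nonlin F (l # w) (complex_of_real x))"
        using gap kl vw unfolding nonlin_gap_def by blast
      have "set (k # v) \<subseteq> {1..N}" "set (l # w) \<subseteq> {1..N}" using kl vw by auto
      note c = close[OF this(1) x(1)] close[OF this(2) x(1)]
      have tri: "cmod (a - b) \<le> cmod (a' - b') + cmod (a - a') + cmod (b - b')" for a b a' b' :: complex
        by norm
      show ?thesis
        using x c tri[of "word_nonlin F (k # v) (complex_of_real x)" "word_nonlin F (l # w) (complex_of_real x)"
            "word_nonlin G (k # v) (complex_of_real x)" "word_nonlin G (l # w) (complex_of_real x)"]
        by (intro bexI[OF _ x(1)]) linarith
    qed
    then show ?thesis unfolding nonlin_gap_def using \<open>0 < \<delta>\<close> by (simp del: word_nonlin.simps)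
  qed
  with r(1) show ?thesis by blast
qed

end

lemma d2_IFS_less_iff: "0 < N \<Longrightarrow> d2_IFS N \<Phi> \<Psi> < r \<longleftrightarrow> (\<forall>k\<in>{1..N}. d2 (\<Phi> k) (\<Psi> k) < r)"
  unfolding d2_IFS_def by (subst Max_less_iff) auto

lemma IFS_ext:
  assumes "\<Phi> \<in> IFS \<epsilon> N"
  obtains F where "\<And>k. k \<in> {1..N} \<Longrightarrow> analytic_ext \<epsilon> (\<Phi> k) (F k)"
proof -
  have "\<forall>k\<in>{1..N}. \<exists>F. analytic_ext \<epsilon> (\<Phi> k) F"
    using assms unfolding IFS_def S_omega_iff[symmetric] by blast
  from bchoice[OF this] show ?thesis using that by blast
qed

text \<open>The choice of the extensions is immaterial: the gap involves them only along real
  orbits, where they and their derivatives are determined by the real maps.\<close>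

definition separated_IFS :: "real \<Rightarrow> nat \<Rightarrow> (nat \<Rightarrow> real \<Rightarrow> real) set" where
  "separated_IFS \<epsilon> N = {\<Phi> \<in> IFS \<epsilon> N.
    \<exists>F \<delta>. (\<forall>k\<in>{1..N}. analytic_ext \<epsilon> (\<Phi> k) (F k)) \<and> nonlin_gap N F \<delta>}"

theorem theorem1p4:
  fixes \<epsilon> :: real and N :: nat
  assumes "\<epsilon> > 0" and "N > 0"
  shows "\<exists>U. U \<subseteq> {\<Phi> \<in> IFS \<epsilon> N. SESC N \<Phi>} \<and>
             openin (C2_topology \<epsilon> N) U \<and>
             (C2_topology \<epsilon> N) closure_of U = IFS \<epsilon> N"
proof (intro exI conjI)
  show "separated_IFS \<epsilon> N \<subseteq> {\<Phi> \<in> IFS \<epsilon> N. SESC N \<Phi>}"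
  proof
    fix \<Phi> assume "\<Phi> \<in> separated_IFS \<epsilon> N"
    then obtain F \<delta> where \<Phi>: "\<Phi> \<in> IFS \<epsilon> N"
      and F: "\<And>k. k \<in> {1..N} \<Longrightarrow> analytic_ext \<epsilon> (\<Phi> k) (F k)" and gap: "nonlin_gap N F \<delta>"
      unfolding separated_IFS_def by blast
    obtain s where "analytic_ifs \<epsilon> s N \<Phi> F"
      using analytic_ifs_exists[where N = N and \<Phi> = \<Phi> and F = F, OF assms(1) F] by blast
    then show "\<Phi> \<in> {\<Phi> \<in> IFS \<epsilon> N. SESC N \<Phi>}"
      using analytic_ifs.SESC_if_nonlin_gap[OF _ gap] \<Phi> by blast
  qed
  show "openin (C2_topology \<epsilon> N) (separated_IFS \<epsilon> N)"
    unfolding openin_C2_topology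
  proof (intro conjI ballI)
    show "separated_IFS \<epsilon> N \<subseteq> IFS \<epsilon> N" by (auto simp: separated_IFS_def)
    fix \<Phi> assume "\<Phi> \<in> separated_IFS \<epsilon> N"
    then obtain F \<delta> where F: "\<And>k. k \<in> {1..N} \<Longrightarrow> analytic_ext \<epsilon> (\<Phi> k) (F k)"
      and gap: "nonlin_gap N F \<delta>"
      unfolding separated_IFS_def by blast
    obtain s where s: "analytic_ifs \<epsilon> s N \<Phi> F"
      using analytic_ifs_exists[where N = N and \<Phi> = \<Phi> and F = F, OF assms(1) F] by blast
    obtain r where r: "r > 0" "\<And>\<Psi> G. (\<forall>k\<in>{1..N}. analytic_ext \<epsilon> (\<Psi> k) (G k) \<and> d2 (\<Phi> k) (\<Psi> k) < r) \<Longrightarrow>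
        nonlin_gap N G (\<delta> / 2)"
      using analytic_ifs.nonlin_gap_stable[OF s F gap] by blast
    have "\<Psi> \<in> separated_IFS \<epsilon> N" if \<Psi>: "\<Psi> \<in> IFS \<epsilon> N" "d2_IFS N \<Phi> \<Psi> < r" for \<Psi>
    proof -
      obtain G where G: "\<And>k. k \<in> {1..N} \<Longrightarrow> analytic_ext \<epsilon> (\<Psi> k) (G k)"
        using IFS_ext[OF \<Psi>(1)] by blast
      have "nonlin_gap N G (\<delta> / 2)"
        using G \<Psi>(2)[unfolded d2_IFS_less_iff[OF assms(2)]] by (intro r(2)[of \<Psi>]) blast
      then show ?thesis unfolding separated_IFS_def using G \<Psi>(1) by blast
    qed
    with r(1) show "\<exists>r>0. {\<Psi> \<in> IFS \<epsilon> N. d2_IFS N \<Phi> \<Psi> < r} \<subseteq> separated_IFS \<epsilon> N" by blast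
  qed
  show "(C2_topology \<epsilon> N) closure_of (separated_IFS \<epsilon> N) = IFS \<epsilon> N"
  proof (intro equalityI subsetI)
    show "\<Phi> \<in> IFS \<epsilon> N" if "\<Phi> \<in> (C2_topology \<epsilon> N) closure_of (separated_IFS \<epsilon> N)" for \<Phi>
      using that by (simp add: in_closure_of)
    fix \<Phi> assume \<Phi>: "\<Phi> \<in> IFS \<epsilon> N"
    show "\<Phi> \<in> (C2_topology \<epsilon> N) closure_of (separated_IFS \<epsilon> N)"
      unfolding in_closure_of topspace_C2_topology
    proof (intro conjI \<Phi> allI impI)
      fix T assume T: "\<Phi> \<in> T \<and> openin (C2_topology \<epsilon> N) T"
      then obtain r where r: "r > 0" "{\<Psi> \<in> IFS \<epsilon> N. d2_IFS N \<Phi> \<Psi> < r} \<subseteq> T"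
        unfolding openin_C2_topology by blast
      obtain F where F: "\<And>k. k \<in> {1..N} \<Longrightarrow> analytic_ext \<epsilon> (\<Phi> k) (F k)"
        using IFS_ext[OF \<Phi>] by blast
      obtain s where s: "analytic_ifs \<epsilon> s N \<Phi> F"
        using analytic_ifs_exists[where N = N and \<Phi> = \<Phi> and F = F, OF assms(1) F] by blast
      obtain \<Psi> G \<delta> where \<Psi>: "\<And>k. k \<in> {1..N} \<Longrightarrow> analytic_ext \<epsilon> (\<Psi> k) (G k)"
        "\<And>k. k \<in> {1..N} \<Longrightarrow> d2 (\<Phi> k) (\<Psi> k) < r" and gap: "nonlin_gap N G \<delta>"
        using analytic_ifs.nonlin_gap_dense[OF s assms(2) F r(1)] by blast
      \<comment> \<open>Elements of \<open>IFS\<close> are extensional functions, so the perturbed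
        system has to be cut off outside the index set.\<close>
      define \<Psi>' where "\<Psi>' = restrict \<Psi> {1..N}"
      have eq: "\<Psi>' k = \<Psi> k" if "k \<in> {1..N}" for k using that by (simp add: \<Psi>'_def)
      have "\<Psi>' \<in> IFS \<epsilon> N"
        unfolding IFS_def \<Psi>'_def using \<Psi>(1) S_omega_iff by (intro restrict_PiE_iff[THEN iffD2]) blast
      moreover have "d2_IFS N \<Phi> \<Psi>' < r"
        unfolding d2_IFS_less_iff[OF assms(2)] using \<Psi>(2) eq by simp
      moreover have "\<forall>k\<in>{1..N}. analytic_ext \<epsilon> (\<Psi>' k) (G k)"
        using \<Psi>(1) eq by simp
      ultimately have "\<Psi>' \<in> separated_IFS \<epsilon> N" "\<Psi>' \<in> T"
        using r(2) gap unfolding separated_IFS_def by blast+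
      then show "\<exists>\<Psi>. \<Psi> \<in> separated_IFS \<epsilon> N \<and> \<Psi> \<in> T" by blast
    qed
  qed
qed

end
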